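(* Let $M=(\mathcal P_1\uplus\mathcal P_2,\mathcal R,m,f)$ be a DP problem. If $(\succsim,\succcurlyeq,\succ)$ is a reduction triple such that (1) $\ell\succsim r$ for all $\ell\Rightarrow r\in\mathcal R$; (2) $\ell\succ p$ for all $\ell\Rrightarrow p\ (A)\in\mathcal P_1$; (3) $\ell\succcurlyeq p$ for all $\ell\Rrightarrow p\ (A)\in\mathcal P_2$, then the processor that maps $M$ to $\{(\mathcal P_2,\mathcal R,m,f)\}$ (and every DP problem for which no such data is given to the singleton containing itself) is both sound and complete.
   Context: Basic notions (higher-order rewriting with meta-variables). Types are built from sorts by $\to$. There are disjoint sets of function symbols, variables $\mathcal V$ and meta-variables (each typed; meta-variables $Z$ have an arity; infinitely many variables and meta-variables of each type). Meta-terms are built from variables, function symbols, application $s\,t$, abstraction $\lambda x.s$ and meta-variable applications $Z\langle s_1,..,s_k\rangle$ ($k=\mathit{arity}(Z)$), all well-typed; terms are meta-terms without meta-variables; modulo $\alpha$; $FV,FMV$ = free variables, meta-variables; closed = no free variables. A pattern is $Z\langle x_1..x_k\rangle$ (distinct variables), $\lambda x.\ell$, or $a\,\ell_1\cdots\ell_n$ with $a$ a function symbol or variable. Substitutions map variables/meta-variables to (meta-)terms; $Z\langle s_1..s_k\rangle\gamma=u[x_1:=s_1\gamma..x_n:=s_n\gamma](s_{n+1}\gamma)\cdots(s_k\gamma)$ if $\gamma(Z)=\lambda x_1..x_n.u$ ($n=k$, or $n<k$ and $u$ not an abstraction), otherwise substitution is homomorphic and capture-avoiding. A rule is $\ell\Rightarrow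 r$ with $\ell,r$ closed meta-terms of the same type, $\ell$ a pattern $\mathsf f\,\ell_1\cdots\ell_n$, $FMV(r)\subseteq FMV(\ell)$. $\to_{\mathcal R}$ is the closure under all contexts of $\ell\delta\to r\delta$ ($\ell\Rightarrow r\in\mathcal R$, $\mathrm{dom}(\delta)=FMV(\ell)$) and $\beta$: $(\lambda x.s)t\to s[x:=t]$ (written $\to_\beta$). The signature used for terms contains marked symbols $\mathsf f^\sharp$, and for each type countably many symbols not used in the rules. Dependency pairs: a DP is a triple $\ell\Rrightarrow p\ (A)$ with $\ell$ a closed pattern $\mathsf f\,\ell_1\cdots\ell_k$, $p$ a closed meta-term $\mathsf g\,p_1\cdots p_n$, $A$ a set of conditions $Z:i$; conservative if $FMV(p)\subseteq FMV(\ell)$. $\gamma$ respects $A$ if for all $Z:i\in A$, $\gamma(Z)=\lambda x_1..x_j.t$ with $i>j$ or ($i\le j$ and $x_i\in FV(t)$). $s\trianglerighteq^\beta_A t$: $s=t$; or $s=\lambda x.u$, $u\trianglerighteq^\beta_A t$; or $s=(\lambda x.u)s_0\cdots s_n$ and some $s_i\trianglerighteq^\beta_At$ or $u[x:=s_0]s_1\cdots s_n\trianglerighteq^\beta_At$; or $s=a\,s_1\cdots s_n$ ($a$ function symbol or variable) and some $s_i\trianglerighteq^\beta_At$; or $s=Z\langle t_1..t_e\rangle s_1\cdots s_n$ and some $s_i\trianglerighteq^\beta_At$, or some $t_i\trianglerighteq^\beta_At$ with $(Z:i)\in A$. Chains: a $(\mathcal P,\mathcal R)$-chain is a finite or infinite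 sequence $[(\ell_0\Rrightarrow p_0(A_0),s_0,t_0),\dots]$ of DPs in $\mathcal P$ and terms such that for all $i$ some substitution $\gamma_i$ on domain $FMV(\ell_i)\cup FMV(p_i)$ respecting $A_i$ has $s_i=\ell_i\gamma_i,t_i=p_i\gamma_i$, and $t_i=\mathsf f\,u_1\cdots u_n$, $s_{i+1}=\mathsf f\,w_1\cdots w_n$ with $u_j\to^*_{\mathcal R}w_j$. Minimal: strict subterms of all $t_i$ are $\to_{\mathcal R}$-terminating. Computable: fix a sort quasi-ordering with well-founded strict part; for a type $\sigma_1\to..\to\sigma_m\to\kappa$ and sort $\iota$, $\iota\succeq_+\sigma$ iff $\iota\succeq\kappa$ and $\iota\succ_-\sigma_i$ for all $i$, $\iota\succ_-\sigma$ iff $\iota\succ\kappa$ and $\iota\succeq_+\sigma_i$ for all $i$; $\mathit{Acc}(\mathsf f)=\{i\mid\iota\succeq_+\sigma_i\}$ for $\mathsf f:\sigma_1\to..\to\sigma_m\to\iota$. For rules $\mathcal U$, an RC-set is a set $I$ of base-type terms, all $\to_{\mathcal U}$-terminating, closed under $\to_{\mathcal U}$, containing each $x\,s_1..s_n$ ($x\in\mathcal V$) or $(\lambda x.u)s_0..s_n$ whose reducts all lie in $I$; $I$-computable: base-type terms in $I$, and $s:\sigma\to\tau$ with $s\,t$ $I$-computable for all $I$-computable $t$. $\mathsf f\,s_1..s_m\rightsquigarrow_I s_i\,t_1..t_n$ if both sides have base type, $i\in\mathit{Acc}(\mathsf f)$, all $t_j$ $I$-computable. $C_{\mathcal U}$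 is an RC-set with $C_{\mathcal U}=\{s$ base type, terminating under $\to_{\mathcal U}\cup\rightsquigarrow_{C_{\mathcal U}}$, with $s\to^*_{\mathcal U}\mathsf f\,s_1..s_m$ implying $s_i$ $C_{\mathcal U}$-computable for $i\in\mathit{Acc}(\mathsf f)\}$. A chain is $\mathcal U$-computable if $\to_{\mathcal U}\supseteq\to_{\mathcal R}$ and for all $i$, $(\lambda x_1..x_n.v)\gamma_i$ is $C_{\mathcal U}$-computable whenever $p_i\trianglerighteq^\beta_Bv$, $\gamma_i$ respects $B$, $FV(v)=\{x_1..x_n\}$. Formative: a reduction $s\to^*_{\mathcal R}\ell\gamma$ is $\ell$-formative if inductively: $\ell$ is not fully extended linear (a meta-variable occurs twice, or $\ell$ has a sub-meta-term $\lambda x.C[Z\langle\vec s\rangle]$ with $x\notin\vec s$); or $\ell=Z\langle\vec x\rangle$ and $s=\ell\gamma$; or $s=a\,s_1..s_n$, $\ell=a\,\ell_1..\ell_n$ ($a$ a (marked) function symbol or variable) with $s_i\to^*\ell_i\gamma$ $\ell_i$-formative; or $s=\lambda x.s'$, $\ell=\lambda x.\ell'$, $s'\to^*\ell'\gamma$ $\ell'$-formative; or $s=(\lambda x.u)v\,w_1..w_n$ and $u[x:=v]w_1..w_n\to^*\ell\gamma$ $\ell$-formative; or $\ell$ is not a meta-variable application and there are a rule $\ell'\Rightarrow r'$, meta-variables $Z_1..Z_n$, $\delta$ with $s\to^*(\ell'Z_1..Z_n)\delta$ $(\ell'Z_1..Z_n)$-formative and $(r'Z_1..Z_n)\delta\to^*\ell\gamma$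 $\ell$-formative. A chain is formative if each $t_i\to^*_{\mathcal R}s_{i+1}$ is $\ell_{i+1}$-formative. DP problems: $(\mathcal P,\mathcal R,m,f)$ with $m\in\{\mathtt{minimal},\mathtt{arbitrary}\}\cup\{\mathtt{computable}_{\mathcal U}\}$, $f\in\{\mathtt{formative},\mathtt{all}\}$. Finite: no infinite $(\mathcal P,\mathcal R)$-chain that is $\mathcal U$-computable if $m=\mathtt{computable}_{\mathcal U}$, minimal if $m=\mathtt{minimal}$, formative if $f=\mathtt{formative}$. Infinite: $\to_{\mathcal R}$ non-terminating or an infinite $(\mathcal P,\mathcal R)$-chain with only conservative DPs exists. A processor maps a DP problem to NO or a set of DP problems; sound if $M$ is finite whenever $\mathit{Proc}(M)\ne$ NO and all its elements are finite; complete if $M$ is infinite whenever $\mathit{Proc}(M)=$ NO or contains an infinite element. Reduction triple: $(\succsim,\succcurlyeq,\succ)$ with $\succsim,\succcurlyeq$ quasi-orderings and $\succ$ a well-founded strict ordering on meta-terms, such that $\succsim$ is monotonic (closed under application contexts on either side and under $\lambda$), all three are meta-stable ($\ell\,R\,r$ implies $\ell\gamma\,R\,r\gamma$ whenever $\ell$ is a closed pattern and $\gamma$ a substitution on domain $FMV(\ell)\cup FMV(r)$), $\to_\beta\subseteq\succsim$, $\succsim\circ\succ\subseteq\succ$ and $\succcurlyeq\circ\succ\subseteq\succ$. *)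

theory Defs
  imports Main
begin

section \<open>Types and raw syntax\<close>

datatype 's ty = Sort 's | Fun "'s ty" "'s ty"

primrec arg_types :: "'s ty \<Rightarrow> 's ty list" where
  "arg_types (Sort \<kappa>) = []"
| "arg_types (Fun \<sigma> \<tau>) = \<sigma> # arg_types \<tau>"

primrec target :: "'s ty \<Rightarrow> 's" where
  "target (Sort \<kappa>) = \<kappa>"
| "target (Fun \<sigma> \<tau>) = target \<tau>"

datatype 'f sym = Plain 'f | Marked 'f

text \<open>
  Meta-terms modulo \<open>\<alpha>\<close> are represented in locally nameless style: free variables are named,
  bound ones are de Bruijn indices, so that \<open>\<alpha>\<close>-equality is equality. Named abstraction
  \<open>\<lambda>x. s\<close> is the function \<open>lam x s\<close> below; all later definitions are phrased with it, and the
  constructors \<open>Bnd\<close> and \<open>Lam\<close> are only used for the operations of this section.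
  The raw type also contains ill-typed expressions and dangling indices; these are excluded by
  the typing relation.
\<close>

datatype ('s, 'f, 'v, 'm) mterm =
    Var 'v
  | Bnd nat
  | Fn "'f sym"
  | App "('s, 'f, 'v, 'm) mterm" "('s, 'f, 'v, 'm) mterm"
  | Lam "'s ty" "('s, 'f, 'v, 'm) mterm"
  | MApp 'm "('s, 'f, 'v, 'm) mterm list"

abbreviation apps :: "('s, 'f, 'v, 'm) mterm \<Rightarrow> ('s, 'f, 'v, 'm) mterm list \<Rightarrow> ('s, 'f, 'v, 'm) mterm" where
  "apps s ts \<equiv> foldl App s ts"

primrec FV :: "('s, 'f, 'v, 'm) mterm \<Rightarrow> 'v set" where
  "FV (Var x) = {x}"
| "FV (Bnd i) = {}"
| "FV (Fn f) = {}"
| "FV (App s t) = FV s \<union> FV t"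
| "FV (Lam \<sigma> s) = FV s"
| "FV (MApp Z ss) = \<Union> (set (map FV ss))"

primrec syms :: "('s, 'f, 'v, 'm) mterm \<Rightarrow> 'f sym set" where
  "syms (Var x) = {}"
| "syms (Bnd i) = {}"
| "syms (Fn f) = {f}"
| "syms (App s t) = syms s \<union> syms t"
| "syms (Lam \<sigma> s) = syms s"
| "syms (MApp Z ss) = \<Union> (set (map syms ss))"

text \<open>The list of all meta-variable occurrences, with repetitions.\<close>

primrec mvar_occs :: "('s, 'f, 'v, 'm) mterm \<Rightarrow> 'm list" where
  "mvar_occs (Var x) = []"
| "mvar_occs (Bnd i) = []"
| "mvar_occs (Fn f) = []"
| "mvar_occs (App s t) = mvar_occs s @ mvar_occs t"
| "mvar_occs (Lam \<sigma> s) = mvar_occs s"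
| "mvar_occs (MApp Z ss) = Z # concat (map mvar_occs ss)"

definition FMV :: "('s, 'f, 'v, 'm) mterm \<Rightarrow> 'm set" where
  "FMV s = set (mvar_occs s)"

primrec close :: "'v \<Rightarrow> nat \<Rightarrow> ('s, 'f, 'v, 'm) mterm \<Rightarrow> ('s, 'f, 'v, 'm) mterm" where
  "close x k (Var y) = (if y = x then Bnd k else Var y)"
| "close x k (Bnd i) = Bnd i"
| "close x k (Fn f) = Fn f"
| "close x k (App s t) = App (close x k s) (close x k t)"
| "close x k (Lam \<sigma> s) = Lam \<sigma> (close x (Suc k) s)"
| "close x k (MApp Z ss) = MApp Z (map (close x k) ss)"

primrec lift :: "nat \<Rightarrow> nat \<Rightarrow> ('s, 'f, 'v, 'm) mterm \<Rightarrow> ('s, 'f, 'v, 'm) mterm" where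
  "lift n k (Var y) = Var y"
| "lift n k (Bnd i) = Bnd (if i < k then i else i + n)"
| "lift n k (Fn f) = Fn f"
| "lift n k (App s t) = App (lift n k s) (lift n k t)"
| "lift n k (Lam \<sigma> s) = Lam \<sigma> (lift n (Suc k) s)"
| "lift n k (MApp Z ss) = MApp Z (map (lift n k) ss)"

text \<open>Simultaneous replacement of the indices \<open>k, k + 1, \<dots>\<close> by the members of \<open>us\<close>.\<close>

primrec inst :: "('s, 'f, 'v, 'm) mterm list \<Rightarrow> nat \<Rightarrow> ('s, 'f, 'v, 'm) mterm \<Rightarrow> ('s, 'f, 'v, 'm) mterm" where
  "inst us k (Var y) = Var y"
| "inst us k (Bnd i) =
    (if i < k then Bnd i
     else if i < k + length us then lift k 0 (us ! (i - k))
     else Bnd (i - length us))"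
| "inst us k (Fn f) = Fn f"
| "inst us k (App s t) = App (inst us k s) (inst us k t)"
| "inst us k (Lam \<sigma> s) = Lam \<sigma> (inst us (Suc k) s)"
| "inst us k (MApp Z ss) = MApp Z (map (inst us k) ss)"

fun lead :: "('s, 'f, 'v, 'm) mterm \<Rightarrow> nat" where
  "lead (Lam \<sigma> s) = Suc (lead s)"
| "lead s = 0"

fun strip :: "nat \<Rightarrow> ('s, 'f, 'v, 'm) mterm \<Rightarrow> ('s, 'f, 'v, 'm) mterm" where
  "strip (Suc n) (Lam \<sigma> s) = strip n s"
| "strip n s = s"

text \<open>
  \<open>mapply (\<lambda>x\<^sub>1 \<dots> x\<^sub>n. u) [t\<^sub>1, \<dots>, t\<^sub>k] = u[x\<^sub>1 := t\<^sub>1, \<dots>, x\<^sub>n := t\<^sub>n] t\<^bsub>n+1\<^esub> \<dots> t\<^sub>k\<close> for \<open>n = k\<close>, or \<open>n < k\<close> and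
  \<open>u\<close> not an abstraction; see \<open>mapply_lams\<close> below.
\<close>

definition mapply :: "('s, 'f, 'v, 'm) mterm \<Rightarrow> ('s, 'f, 'v, 'm) mterm list \<Rightarrow> ('s, 'f, 'v, 'm) mterm" where
  "mapply u ts = (let n = min (length ts) (lead u) in
     apps (inst (rev (take n ts)) 0 (strip n u)) (drop n ts))"

text \<open>
  A substitution maps variables (\<open>Inl\<close>) and meta-variables (\<open>Inr\<close>); outside its domain it acts
  as the identity. Its images have no dangling indices, hence no lifting under \<open>Lam\<close> is needed.
\<close>

type_synonym ('s, 'f, 'v, 'm) subst = "'v + 'm \<rightharpoonup> ('s, 'f, 'v, 'm) mterm"

primrec subst :: "('s, 'f, 'v, 'm) subst \<Rightarrow> ('s, 'f, 'v, 'm) mterm \<Rightarrow> ('s, 'f, 'v, 'm) mterm" where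
  "subst \<gamma> (Var x) = (case \<gamma> (Inl x) of None \<Rightarrow> Var x | Some u \<Rightarrow> u)"
| "subst \<gamma> (Bnd i) = Bnd i"
| "subst \<gamma> (Fn f) = Fn f"
| "subst \<gamma> (App s t) = App (subst \<gamma> s) (subst \<gamma> t)"
| "subst \<gamma> (Lam \<sigma> s) = Lam \<sigma> (subst \<gamma> s)"
| "subst \<gamma> (MApp Z ss) =
    (case \<gamma> (Inr Z) of
       None \<Rightarrow> MApp Z (map (subst \<gamma>) ss)
     | Some u \<Rightarrow> mapply u (map (subst \<gamma>) ss))"

abbreviation subst1 :: "'v \<Rightarrow> ('s, 'f, 'v, 'm) mterm \<Rightarrow> ('s, 'f, 'v, 'm) mterm \<Rightarrow> ('s, 'f, 'v, 'm) mterm" where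
  "subst1 x t s \<equiv> subst [Inl x \<mapsto> t] s"

definition fresh_for :: "'v \<Rightarrow> ('s, 'f, 'v, 'm) subst \<Rightarrow> bool" where
  "fresh_for x \<gamma> \<longleftrightarrow> Inl x \<notin> dom \<gamma> \<and> (\<forall>u \<in> ran \<gamma>. x \<notin> FV u)"


section \<open>Dependency pairs, chains and DP problems: data\<close>

type_synonym ('s, 'f, 'v, 'm) rrule = "('s, 'f, 'v, 'm) mterm \<times> ('s, 'f, 'v, 'm) mterm"

text \<open>A condition \<open>Z : i\<close> is the pair \<open>(Z, i)\<close>; argument positions are counted from 1.\<close>

type_synonym ('s, 'f, 'v, 'm) dp =
  "('s, 'f, 'v, 'm) mterm \<times> ('s, 'f, 'v, 'm) mterm \<times> ('m \<times> nat) set"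

datatype ('s, 'f, 'v, 'm) mflag = Minimal | Arbitrary | Computable "('s, 'f, 'v, 'm) rrule set"

datatype fflag = Formative | All

type_synonym ('s, 'f, 'v, 'm) dpp =
  "('s, 'f, 'v, 'm) dp set \<times> ('s, 'f, 'v, 'm) rrule set \<times> ('s, 'f, 'v, 'm) mflag \<times> fflag"

datatype 'a result = NO | Problems "'a set"

type_synonym ('s, 'f, 'v, 'm) mrel = "('s, 'f, 'v, 'm) mterm \<Rightarrow> ('s, 'f, 'v, 'm) mterm \<Rightarrow> bool"

fun conservative :: "('s, 'f, 'v, 'm) dp \<Rightarrow> bool" where
  "conservative (l, p, A) \<longleftrightarrow> FMV p \<subseteq> FMV l"


section \<open>The higher-order rewriting framework\<close>

text \<open>
  \<open>rule_syms\<close> is the set of (unmarked) function symbols that may be used in rules. The function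
  symbols available in terms are all \<open>Plain f\<close> and \<open>Marked f\<close>.
\<close>

record ('s, 'f, 'v, 'm) signature =
  fun_type :: "'f \<Rightarrow> 's ty"
  rule_syms :: "'f set"
  var_type :: "'v \<Rightarrow> 's ty"
  mvar_type :: "'m \<Rightarrow> 's ty"
  mvar_arity :: "'m \<Rightarrow> nat"
  sort_ge :: "'s \<Rightarrow> 's \<Rightarrow> bool"

definition sort_gt :: "('s, 'f, 'v, 'm) signature \<Rightarrow> 's \<Rightarrow> 's \<Rightarrow> bool" where
  "sort_gt S \<iota> \<kappa> \<longleftrightarrow> sort_ge S \<iota> \<kappa> \<and> \<not> sort_ge S \<kappa> \<iota>"

locale framework =
  fixes S :: "('s, 'f, 'v, 'm) signature"
  assumes infinite_vars: "infinite {x. var_type S x = \<sigma>}"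
    and infinite_mvars: "infinite {Z. mvar_type S Z = \<sigma>}"
    and infinite_unused_syms: "infinite {f. fun_type S f = \<sigma> \<and> f \<notin> rule_syms S}"
    and arity_le: "mvar_arity S Z \<le> length (arg_types (mvar_type S Z))"
    and sort_ge_refl: "reflp (sort_ge S)"
    and sort_ge_trans: "transp (sort_ge S)"
    and sort_gt_wf: "wfp (\<lambda>\<kappa> \<iota>. sort_gt S \<iota> \<kappa>)"
begin

subsection \<open>Meta-terms and terms\<close>

primrec sym_type :: "'f sym \<Rightarrow> 's ty" where
  "sym_type (Plain f) = fun_type S f"
| "sym_type (Marked f) = fun_type S f"

definition lam :: "'v \<Rightarrow> ('s, 'f, 'v, 'm) mterm \<Rightarrow> ('s, 'f, 'v, 'm) mterm" where
  "lam x s = Lam (var_type S x) (close x 0 s)"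

abbreviation lams :: "'v list \<Rightarrow> ('s, 'f, 'v, 'm) mterm \<Rightarrow> ('s, 'f, 'v, 'm) mterm" where
  "lams xs s \<equiv> foldr lam xs s"

inductive has_type :: "('s, 'f, 'v, 'm) mterm \<Rightarrow> 's ty \<Rightarrow> bool" where
  "has_type (Var x) (var_type S x)"
| "has_type (Fn f) (sym_type f)"
| "has_type s (Fun \<sigma> \<tau>) \<Longrightarrow> has_type t \<sigma> \<Longrightarrow> has_type (App s t) \<tau>"
| "has_type s \<tau> \<Longrightarrow> has_type (lam x s) (Fun (var_type S x) \<tau>)"
| "length ss = mvar_arity S Z \<Longrightarrow> mvar_type S Z = foldr Fun \<sigma>s \<tau> \<Longrightarrow> list_all2 has_type ss \<sigma>s
    \<Longrightarrow> has_type (MApp Z ss) \<tau>"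

definition meta_terms :: "('s, 'f, 'v, 'm) mterm set" where
  "meta_terms = {s. \<exists>\<sigma>. has_type s \<sigma>}"

definition "terms" :: "('s, 'f, 'v, 'm) mterm set" where
  "terms = {s \<in> meta_terms. FMV s = {}}"

definition base_terms :: "('s, 'f, 'v, 'm) mterm set" where
  "base_terms = {s \<in> terms. \<exists>\<kappa>. has_type s (Sort \<kappa>)}"

definition is_abs :: "('s, 'f, 'v, 'm) mterm \<Rightarrow> bool" where
  "is_abs s \<longleftrightarrow> (\<exists>x u. u \<in> meta_terms \<and> s = lam x u)"

inductive imm_sub :: "('s, 'f, 'v, 'm) mrel" where
  "s \<in> meta_terms \<Longrightarrow> imm_sub (lam x s) s"
| "imm_sub (App s t) s"
| "imm_sub (App s t) t"
| "s \<in> set ss \<Longrightarrow> imm_sub (MApp Z ss) s"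

abbreviation sub_eq :: "('s, 'f, 'v, 'm) mrel" where "sub_eq \<equiv> imm_sub\<^sup>*\<^sup>*"

abbreviation strict_sub :: "('s, 'f, 'v, 'm) mrel" where "strict_sub \<equiv> imm_sub\<^sup>+\<^sup>+"

inductive pattern :: "('s, 'f, 'v, 'm) mterm \<Rightarrow> bool" where
  "distinct xs \<Longrightarrow> pattern (MApp Z (map Var xs))"
| "pattern l \<Longrightarrow> pattern (lam x l)"
| "\<forall>l \<in> set ls. pattern l \<Longrightarrow> pattern (apps (Fn f) ls)"
| "\<forall>l \<in> set ls. pattern l \<Longrightarrow> pattern (apps (Var x) ls)"

definition closed_pattern :: "('s, 'f, 'v, 'm) mterm \<Rightarrow> bool" where
  "closed_pattern l \<longleftrightarrow> l \<in> meta_terms \<and> pattern l \<and> FV l = {}"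


subsection \<open>Substitutions, rules and rewriting\<close>

definition substitution :: "('s, 'f, 'v, 'm) subst \<Rightarrow> bool" where
  "substitution \<gamma> \<longleftrightarrow>
     (\<forall>x u. \<gamma> (Inl x) = Some u \<longrightarrow> u \<in> terms \<and> has_type u (var_type S x)) \<and>
     (\<forall>Z u. \<gamma> (Inr Z) = Some u \<longrightarrow> u \<in> terms \<and> has_type u (mvar_type S Z))"

fun is_rule :: "('s, 'f, 'v, 'm) rrule \<Rightarrow> bool" where
  "is_rule (l, r) \<longleftrightarrow>
     closed_pattern l \<and> FV r = {} \<and>
     (\<exists>\<sigma>. has_type l \<sigma> \<and> has_type r \<sigma>) \<and>
     (\<exists>f ls. l = apps (Fn f) ls) \<and>
     FMV r \<subseteq> FMV l \<and>
     syms l \<union> syms r \<subseteq> Plain ` rule_syms S"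

inductive step :: "('s, 'f, 'v, 'm) rrule set \<Rightarrow> ('s, 'f, 'v, 'm) mrel"
  for R :: "('s, 'f, 'v, 'm) rrule set"
where
  rule: "(l, r) \<in> R \<Longrightarrow> substitution \<delta> \<Longrightarrow> dom \<delta> = Inr ` FMV l \<Longrightarrow>
    step R (subst \<delta> l) (subst \<delta> r)"
| beta: "s \<in> terms \<Longrightarrow> App (lam x s) t \<in> terms \<Longrightarrow> step R (App (lam x s) t) (subst1 x t s)"
| app_left: "step R s s' \<Longrightarrow> App s t \<in> terms \<Longrightarrow> step R (App s t) (App s' t)"
| app_right: "step R t t' \<Longrightarrow> App s t \<in> terms \<Longrightarrow> step R (App s t) (App s t')"
| lam: "step R s s' \<Longrightarrow> step R (lam x s) (lam x s')"

abbreviation beta_step :: "('s, 'f, 'v, 'm) mrel" where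
  "beta_step \<equiv> step {}"


subsection \<open>Dependency pairs\<close>

fun is_dp :: "('s, 'f, 'v, 'm) dp \<Rightarrow> bool" where
  "is_dp (l, p, A) \<longleftrightarrow>
     closed_pattern l \<and> (\<exists>f ls. l = apps (Fn f) ls) \<and>
     p \<in> meta_terms \<and> FV p = {} \<and> (\<exists>g ps. p = apps (Fn g) ps) \<and>
     (\<forall>(Z, i) \<in> A. 1 \<le> i)"

text \<open>
  For distinct \<open>x\<^sub>1, \<dots>, x\<^sub>j\<close> and a body that is not an abstraction, \<open>\<lambda>x\<^sub>1 \<dots> x\<^sub>j. t\<close> is unique up
  to renaming. Meta-variables outside the domain are mapped to \<open>\<lambda>y\<^sub>1 \<dots> y\<^sub>k. Z\<langle>y\<^sub>1, \<dots>, y\<^sub>k\<rangle>\<close>, for which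
  the requirement always holds.
\<close>

definition respects_conds :: "('s, 'f, 'v, 'm) subst \<Rightarrow> ('m \<times> nat) set \<Rightarrow> bool" where
  "respects_conds \<gamma> A \<longleftrightarrow> (\<forall>(Z, i) \<in> A. \<forall>u. \<gamma> (Inr Z) = Some u \<longrightarrow>
     (\<exists>xs t. u = lams xs t \<and> distinct xs \<and> t \<in> meta_terms \<and> \<not> is_abs t \<and>
        (i > length xs \<or> (i \<le> length xs \<and> xs ! (i - 1) \<in> FV t))))"

inductive beta_sub :: "('m \<times> nat) set \<Rightarrow> ('s, 'f, 'v, 'm) mrel"
  for A :: "('m \<times> nat) set"
where
  "beta_sub A s s"
| "u \<in> meta_terms \<Longrightarrow> beta_sub A u t \<Longrightarrow> beta_sub A (lam x u) t"
| "u \<in> meta_terms \<Longrightarrow> v \<in> set (s0 # ss) \<Longrightarrow> beta_sub A v t \<Longrightarrow>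
    beta_sub A (apps (lam x u) (s0 # ss)) t"
| "u \<in> meta_terms \<Longrightarrow> beta_sub A (apps (subst1 x s0 u) ss) t \<Longrightarrow>
    beta_sub A (apps (lam x u) (s0 # ss)) t"
| "v \<in> set ss \<Longrightarrow> beta_sub A v t \<Longrightarrow> beta_sub A (apps (Fn f) ss) t"
| "v \<in> set ss \<Longrightarrow> beta_sub A v t \<Longrightarrow> beta_sub A (apps (Var x) ss) t"
| "v \<in> set ss \<Longrightarrow> beta_sub A v t \<Longrightarrow> beta_sub A (apps (MApp Z ts) ss) t"
| "(Z, i) \<in> A \<Longrightarrow> 1 \<le> i \<Longrightarrow> i \<le> length ts \<Longrightarrow> beta_sub A (ts ! (i - 1)) t \<Longrightarrow>
    beta_sub A (apps (MApp Z ts) ss) t"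


subsection \<open>Computability\<close>

text \<open>\<open>ge_pos \<iota> \<sigma>\<close> is \<open>\<iota> \<succeq>\<^sub>+ \<sigma>\<close> and \<open>gt_neg \<iota> \<sigma>\<close> is \<open>\<iota> \<succ>\<^sub>- \<sigma>\<close>, with the argument types consumed one at a time.\<close>

fun ge_pos :: "'s \<Rightarrow> 's ty \<Rightarrow> bool" and gt_neg :: "'s \<Rightarrow> 's ty \<Rightarrow> bool" where
  "ge_pos \<iota> (Sort \<kappa>) \<longleftrightarrow> sort_ge S \<iota> \<kappa>"
| "ge_pos \<iota> (Fun \<sigma> \<tau>) \<longleftrightarrow> gt_neg \<iota> \<sigma> \<and> ge_pos \<iota> \<tau>"
| "gt_neg \<iota> (Sort \<kappa>) \<longleftrightarrow> sort_gt S \<iota> \<kappa>"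
| "gt_neg \<iota> (Fun \<sigma> \<tau>) \<longleftrightarrow> ge_pos \<iota> \<sigma> \<and> gt_neg \<iota> \<tau>"

definition Acc :: "'f sym \<Rightarrow> nat set" where
  "Acc f = {i. 1 \<le> i \<and> i \<le> length (arg_types (sym_type f)) \<and>
     ge_pos (target (sym_type f)) (arg_types (sym_type f) ! (i - 1))}"

definition RC_set :: "('s, 'f, 'v, 'm) rrule set \<Rightarrow> ('s, 'f, 'v, 'm) mterm set \<Rightarrow> bool" where
  "RC_set U I \<longleftrightarrow>
     I \<subseteq> base_terms \<and>
     (\<forall>s \<in> I. termip (step U) s) \<and>
     (\<forall>s \<in> I. \<forall>t. step U s t \<longrightarrow> t \<in> I) \<and>
     (\<forall>s \<in> base_terms.
        ((\<exists>x ss. s = apps (Var x) ss) \<or>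
         (\<exists>x u s0 ss. u \<in> terms \<and> s = apps (lam x u) (s0 # ss))) \<longrightarrow>
        (\<forall>t. step U s t \<longrightarrow> t \<in> I) \<longrightarrow> s \<in> I)"

primrec comp_at :: "('s, 'f, 'v, 'm) mterm set \<Rightarrow> 's ty \<Rightarrow> ('s, 'f, 'v, 'm) mterm \<Rightarrow> bool" where
  "comp_at I (Sort \<kappa>) = (\<lambda>s. has_type s (Sort \<kappa>) \<and> s \<in> I)"
| "comp_at I (Fun \<sigma> \<tau>) = (\<lambda>s. s \<in> terms \<and> has_type s (Fun \<sigma> \<tau>) \<and>
     (\<forall>t. comp_at I \<sigma> t \<longrightarrow> comp_at I \<tau> (App s t)))"

definition computable :: "('s, 'f, 'v, 'm) mterm set \<Rightarrow> ('s, 'f, 'v, 'm) mterm \<Rightarrow> bool" where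
  "computable I s \<longleftrightarrow> (\<exists>\<sigma>. comp_at I \<sigma> s)"

inductive acc_step :: "('s, 'f, 'v, 'm) mterm set \<Rightarrow> ('s, 'f, 'v, 'm) mrel"
  for I :: "('s, 'f, 'v, 'm) mterm set"
where
  "apps (Fn f) ss \<in> base_terms \<Longrightarrow> apps (ss ! (i - 1)) ts \<in> base_terms \<Longrightarrow> i \<in> Acc f \<Longrightarrow>
    \<forall>t \<in> set ts. computable I t \<Longrightarrow> acc_step I (apps (Fn f) ss) (apps (ss ! (i - 1)) ts)"

definition is_comp_set :: "('s, 'f, 'v, 'm) rrule set \<Rightarrow> ('s, 'f, 'v, 'm) mterm set \<Rightarrow> bool" where
  "is_comp_set U C \<longleftrightarrow> RC_set U C \<and>
     C = {s \<in> base_terms.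
            termip (\<lambda>a b. step U a b \<or> acc_step C a b) s \<and>
            (\<forall>f ss. (step U)\<^sup>*\<^sup>* s (apps (Fn f) ss) \<longrightarrow>
               (\<forall>i \<in> Acc f. computable C (ss ! (i - 1))))}"

text \<open>The equation in \<open>is_comp_set\<close> is recursive in \<open>C\<close>; \<open>comp_set\<close> fixes one of its solutions among the RC-sets.\<close>

definition comp_set :: "('s, 'f, 'v, 'm) rrule set \<Rightarrow> ('s, 'f, 'v, 'm) mterm set" where
  "comp_set U = (SOME C. is_comp_set U C)"


subsection \<open>Formative reductions\<close>

definition fully_extended_linear :: "('s, 'f, 'v, 'm) mterm \<Rightarrow> bool" where
  "fully_extended_linear l \<longleftrightarrow> distinct (mvar_occs l) \<and>
     \<not> (\<exists>x c Z ss. c \<in> meta_terms \<and> sub_eq l (lam x c) \<and> sub_eq c (MApp Z ss) \<and> Var x \<notin> set ss)"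

text \<open>\<open>formative R s l \<gamma>\<close>: there is an \<open>l\<close>-formative reduction from \<open>s\<close> to \<open>subst \<gamma> l\<close>.\<close>

inductive formative ::
  "('s, 'f, 'v, 'm) rrule set \<Rightarrow> ('s, 'f, 'v, 'm) mterm \<Rightarrow> ('s, 'f, 'v, 'm) mterm \<Rightarrow>
   ('s, 'f, 'v, 'm) subst \<Rightarrow> bool"
  for R :: "('s, 'f, 'v, 'm) rrule set"
where
  "\<not> fully_extended_linear l \<Longrightarrow> (step R)\<^sup>*\<^sup>* s (subst \<gamma> l) \<Longrightarrow> formative R s l \<gamma>"
| "l = MApp Z (map Var xs) \<Longrightarrow> s = subst \<gamma> l \<Longrightarrow> formative R s l \<gamma>"
| "(\<exists>f. a = Fn f) \<or> (\<exists>x. a = Var x) \<Longrightarrow> length ss = length ls \<Longrightarrow>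
    \<forall>i < length ls. formative R (ss ! i) (ls ! i) \<gamma> \<Longrightarrow>
    formative R (apps a ss) (apps a ls) \<gamma>"
| "s \<in> terms \<Longrightarrow> l \<in> meta_terms \<Longrightarrow> fresh_for x \<gamma> \<Longrightarrow> formative R s l \<gamma> \<Longrightarrow>
    formative R (lam x s) (lam x l) \<gamma>"
| "u \<in> terms \<Longrightarrow> formative R (apps (subst1 x v u) ws) l \<gamma> \<Longrightarrow>
    formative R (apps (lam x u) (v # ws)) l \<gamma>"
| "\<not> (\<exists>Z ts. l = MApp Z ts) \<Longrightarrow> (l', r') \<in> R \<Longrightarrow> zs = map (\<lambda>Z. MApp Z []) Zs \<Longrightarrow>
    apps l' zs \<in> meta_terms \<Longrightarrow> substitution \<delta> \<Longrightarrow> dom \<delta> = Inr ` FMV (apps l' zs) \<Longrightarrow>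
    formative R s (apps l' zs) \<delta> \<Longrightarrow> formative R (subst \<delta> (apps r' zs)) l \<gamma> \<Longrightarrow>
    formative R s l \<gamma>"


subsection \<open>Chains\<close>

text \<open>
  An infinite chain is given by the functions \<open>\<rho>\<close>, \<open>s\<close>, \<open>t\<close>; the substitutions \<open>\<gamma> i\<close> are the
  witnesses required for each index.
\<close>

definition inf_chain ::
  "('s, 'f, 'v, 'm) dp set \<Rightarrow> ('s, 'f, 'v, 'm) rrule set \<Rightarrow> (nat \<Rightarrow> ('s, 'f, 'v, 'm) dp) \<Rightarrow>
   (nat \<Rightarrow> ('s, 'f, 'v, 'm) mterm) \<Rightarrow> (nat \<Rightarrow> ('s, 'f, 'v, 'm) mterm) \<Rightarrow>
   (nat \<Rightarrow> ('s, 'f, 'v, 'm) subst) \<Rightarrow> bool"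
where
  "inf_chain P R \<rho> s t \<gamma> \<longleftrightarrow> (\<forall>i.
     \<rho> i \<in> P \<and> s i \<in> terms \<and> t i \<in> terms \<and>
     (\<forall>l p A. \<rho> i = (l, p, A) \<longrightarrow>
        substitution (\<gamma> i) \<and> dom (\<gamma> i) = Inr ` (FMV l \<union> FMV p) \<and> respects_conds (\<gamma> i) A \<and>
        s i = subst (\<gamma> i) l \<and> t i = subst (\<gamma> i) p) \<and>
     (\<exists>f us ws. t i = apps (Fn f) us \<and> s (Suc i) = apps (Fn f) ws \<and>
        list_all2 (step R)\<^sup>*\<^sup>* us ws))"

definition minimal_chain ::
  "('s, 'f, 'v, 'm) rrule set \<Rightarrow> (nat \<Rightarrow> ('s, 'f, 'v, 'm) mterm) \<Rightarrow> bool"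
where
  "minimal_chain R t \<longleftrightarrow> (\<forall>i u. strict_sub (t i) u \<longrightarrow> termip (step R) u)"

definition computable_chain ::
  "('s, 'f, 'v, 'm) rrule set \<Rightarrow> ('s, 'f, 'v, 'm) rrule set \<Rightarrow>
   (nat \<Rightarrow> ('s, 'f, 'v, 'm) dp) \<Rightarrow> (nat \<Rightarrow> ('s, 'f, 'v, 'm) subst) \<Rightarrow> bool"
where
  "computable_chain U R \<rho> \<gamma> \<longleftrightarrow>
     (\<forall>a b. step R a b \<longrightarrow> step U a b) \<and>
     (\<forall>i l p A v B xs. \<rho> i = (l, p, A) \<longrightarrow> (\<forall>(Z, j) \<in> B. 1 \<le> j) \<longrightarrow> beta_sub B p v \<longrightarrow>
        respects_conds (\<gamma> i) B \<longrightarrow> distinct xs \<longrightarrow> FV v = set xs \<longrightarrow>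
        computable (comp_set U) (subst (\<gamma> i) (lams xs v)))"

definition formative_chain ::
  "('s, 'f, 'v, 'm) rrule set \<Rightarrow> (nat \<Rightarrow> ('s, 'f, 'v, 'm) dp) \<Rightarrow>
   (nat \<Rightarrow> ('s, 'f, 'v, 'm) mterm) \<Rightarrow> (nat \<Rightarrow> ('s, 'f, 'v, 'm) subst) \<Rightarrow> bool"
where
  "formative_chain R \<rho> t \<gamma> \<longleftrightarrow>
     (\<forall>i. formative R (t i) (fst (\<rho> (Suc i))) (\<gamma> (Suc i)))"


subsection \<open>DP problems and processors\<close>

fun is_dpp :: "('s, 'f, 'v, 'm) dpp \<Rightarrow> bool" where
  "is_dpp (P, R, m, f) \<longleftrightarrow>
     (\<forall>\<rho> \<in> P. is_dp \<rho>) \<and> (\<forall>\<rho> \<in> R. is_rule \<rho>) \<and>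
     (\<forall>U. m = Computable U \<longrightarrow> (\<forall>\<rho> \<in> U. is_rule \<rho>))"

fun dpp_finite :: "('s, 'f, 'v, 'm) dpp \<Rightarrow> bool" where
  "dpp_finite (P, R, m, f) \<longleftrightarrow> \<not> (\<exists>\<rho> s t \<gamma>. inf_chain P R \<rho> s t \<gamma> \<and>
     (\<forall>U. m = Computable U \<longrightarrow> computable_chain U R \<rho> \<gamma>) \<and>
     (m = Minimal \<longrightarrow> minimal_chain R t) \<and>
     (f = Formative \<longrightarrow> formative_chain R \<rho> t \<gamma>))"

fun dpp_infinite :: "('s, 'f, 'v, 'm) dpp \<Rightarrow> bool" where
  "dpp_infinite (P, R, m, f) \<longleftrightarrow>
     (\<exists>s \<in> terms. \<not> termip (step R) s) \<or>
     (\<exists>\<rho> s t \<gamma>. inf_chain P R \<rho> s t \<gamma> \<and> (\<forall>i. conservative (\<rho> i)))"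

definition processor :: "(('s, 'f, 'v, 'm) dpp \<Rightarrow> ('s, 'f, 'v, 'm) dpp result) \<Rightarrow> bool" where
  "processor Proc \<longleftrightarrow> (\<forall>M Ms. is_dpp M \<longrightarrow> Proc M = Problems Ms \<longrightarrow> (\<forall>M' \<in> Ms. is_dpp M'))"

definition sound :: "(('s, 'f, 'v, 'm) dpp \<Rightarrow> ('s, 'f, 'v, 'm) dpp result) \<Rightarrow> bool" where
  "sound Proc \<longleftrightarrow> (\<forall>M Ms. is_dpp M \<longrightarrow> Proc M = Problems Ms \<longrightarrow>
     (\<forall>M' \<in> Ms. dpp_finite M') \<longrightarrow> dpp_finite M)"

definition complete :: "(('s, 'f, 'v, 'm) dpp \<Rightarrow> ('s, 'f, 'v, 'm) dpp result) \<Rightarrow> bool" where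
  "complete Proc \<longleftrightarrow> (\<forall>M. is_dpp M \<longrightarrow>
     Proc M = NO \<or> (\<exists>Ms. Proc M = Problems Ms \<and> (\<exists>M' \<in> Ms. dpp_infinite M')) \<longrightarrow>
     dpp_infinite M)"


subsection \<open>Reduction triples\<close>

definition monotonic :: "('s, 'f, 'v, 'm) mrel \<Rightarrow> bool" where
  "monotonic r \<longleftrightarrow> (\<forall>s \<in> meta_terms. \<forall>t \<in> meta_terms. r s t \<longrightarrow>
     (\<forall>u. App s u \<in> meta_terms \<and> App t u \<in> meta_terms \<longrightarrow> r (App s u) (App t u)) \<and>
     (\<forall>u. App u s \<in> meta_terms \<and> App u t \<in> meta_terms \<longrightarrow> r (App u s) (App u t)) \<and>
     (\<forall>x. r (lam x s) (lam x t)))"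

definition meta_stable :: "('s, 'f, 'v, 'm) mrel \<Rightarrow> bool" where
  "meta_stable rel \<longleftrightarrow> (\<forall>l r \<gamma>. closed_pattern l \<longrightarrow> r \<in> meta_terms \<longrightarrow> rel l r \<longrightarrow>
     substitution \<gamma> \<longrightarrow> dom \<gamma> = Inr ` (FMV l \<union> FMV r) \<longrightarrow> rel (subst \<gamma> l) (subst \<gamma> r))"

definition quasi_ordering :: "('s, 'f, 'v, 'm) mrel \<Rightarrow> bool" where
  "quasi_ordering r \<longleftrightarrow> reflp_on meta_terms r \<and> transp_on meta_terms r"

definition wf_strict_ordering :: "('s, 'f, 'v, 'm) mrel \<Rightarrow> bool" where
  "wf_strict_ordering r \<longleftrightarrow>
     irreflp_on meta_terms r \<and> transp_on meta_terms r \<and> wfp_on meta_terms r\<inverse>\<inverse>"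

definition reduction_triple ::
  "('s, 'f, 'v, 'm) mrel \<Rightarrow> ('s, 'f, 'v, 'm) mrel \<Rightarrow> ('s, 'f, 'v, 'm) mrel \<Rightarrow> bool"
where
  "reduction_triple ge1 ge2 gt \<longleftrightarrow>
     quasi_ordering ge1 \<and> quasi_ordering ge2 \<and> wf_strict_ordering gt \<and>
     monotonic ge1 \<and>
     meta_stable ge1 \<and> meta_stable ge2 \<and> meta_stable gt \<and>
     (\<forall>s t. beta_step s t \<longrightarrow> ge1 s t) \<and>
     (\<forall>s \<in> meta_terms. \<forall>t \<in> meta_terms. \<forall>u \<in> meta_terms. ge1 s t \<longrightarrow> gt t u \<longrightarrow> gt s u) \<and>
     (\<forall>s \<in> meta_terms. \<forall>t \<in> meta_terms. \<forall>u \<in> meta_terms. ge2 s t \<longrightarrow> gt t u \<longrightarrow> gt s u)"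

end

text \<open>
  The data given for a DP problem consists of \<open>P\<^sub>1\<close>, \<open>P\<^sub>2\<close> and the three relations
  \<open>(\<succsim>, \<succcurlyeq>, \<succ>)\<close>; \<open>None\<close> stands for a problem for which no data is given.
\<close>

type_synonym ('s, 'f, 'v, 'm) triple_data =
  "('s, 'f, 'v, 'm) dp set \<times> ('s, 'f, 'v, 'm) dp set \<times>
   ('s, 'f, 'v, 'm) mrel \<times> ('s, 'f, 'v, 'm) mrel \<times> ('s, 'f, 'v, 'm) mrel"

fun triple_proc ::
  "(('s, 'f, 'v, 'm) dpp \<Rightarrow> ('s, 'f, 'v, 'm) triple_data option) \<Rightarrow>
   ('s, 'f, 'v, 'm) dpp \<Rightarrow> ('s, 'f, 'v, 'm) dpp result"
where
  "triple_proc data (P, R, m, f) =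
     (case data (P, R, m, f) of
        None \<Rightarrow> Problems {(P, R, m, f)}
      | Some (P1, P2, _) \<Rightarrow> Problems {(P2, R, m, f)})"


section \<open>Adequacy of the locally nameless representation\<close>

text \<open>
  The main facts are \<open>lam_rename\<close> (\<open>\<alpha>\<close>-conversion), \<open>subst_lam\<close> and \<open>mapply_lams\<close> (the equations for
  applying a substitution to abstractions and meta-variable applications), and
  \<open>step_preserves_type\<close> (rewriting relates terms of the same type).
\<close>

primrec loc_closed :: "nat \<Rightarrow> ('s, 'f, 'v, 'm) mterm \<Rightarrow> bool" where
  "loc_closed k (Var y) = True"
| "loc_closed k (Bnd i) = (i < k)"
| "loc_closed k (Fn f) = True"
| "loc_closed k (App s t) = (loc_closed k s \<and> loc_closed k t)"
| "loc_closed k (Lam \<sigma> s) = loc_closed (Suc k) s"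
| "loc_closed k (MApp Z ss) = list_all (loc_closed k) ss"

lemma close_lift: "m \<le> k \<Longrightarrow> close x (k + n) (lift n m w) = lift n m (close x k w)"
proof (induction w arbitrary: k m)
  case (Lam \<sigma> w)
  from Lam.IH[of "Suc m" "Suc k"] Lam.prems show ?case by simp
qed auto

lemma close_id: "x \<notin> FV s \<Longrightarrow> close x k s = s"
  by (induction s arbitrary: k) (auto simp: map_idI)

lemma FV_close: "FV (close x k s) = FV s - {x}"
  by (induction s arbitrary: k) auto

lemma close_inst:
  "x \<notin> FV v \<Longrightarrow> loc_closed (j + length us) v \<Longrightarrow>
   close x (k + j) (inst us j v) = inst (map (close x k) us) j v"
proof (induction v arbitrary: j)
  case (Bnd i)
  then show ?case by (auto simp: close_lift[of 0 k x j])
next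
  case (Lam \<sigma> v)
  from Lam.IH[of "Suc j"] Lam.prems show ?case by simp
next
  case (MApp Z ss)
  then show ?case by (auto simp: list_all_iff)
qed auto

lemma close_apps: "close x k (apps s ts) = apps (close x k s) (map (close x k) ts)"
  by (induction ts arbitrary: s) auto

lemma strip_props:
  "n \<le> lead u \<Longrightarrow> FV (strip n u) = FV u \<and> (loc_closed k u \<longrightarrow> loc_closed (k + n) (strip n u))"
proof (induction n u arbitrary: k rule: strip.induct)
  case (1 n \<sigma> s)
  then show ?case using "1.IH"[of "Suc k"] by auto
qed auto

lemma close_mapply:
  assumes "x \<notin> FV u" "loc_closed 0 u"
  shows "close x k (mapply u ts) = mapply u (map (close x k) ts)"
proof -
  let ?n = "min (length ts) (lead u)"
  have "FV (strip ?n u) = FV u" "loc_closed (0 + ?n) (strip ?n u)"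
    using strip_props[of ?n u 0] assms by auto
  then have "close x (k + 0) (inst (rev (take ?n ts)) 0 (strip ?n u))
      = inst (map (close x k) (rev (take ?n ts))) 0 (strip ?n u)"
    using assms by (intro close_inst) auto
  then show ?thesis
    by (simp add: mapply_def Let_def close_apps rev_map take_map drop_map)
qed

lemma subst_close:
  assumes "\<And>u. u \<in> ran \<gamma> \<Longrightarrow> loc_closed 0 u" "fresh_for x \<gamma>"
  shows "subst \<gamma> (close x k s) = close x k (subst \<gamma> s)"
proof (induction s arbitrary: k)
  case (Var y)
  then show ?case using assms(2)
    by (auto simp: fresh_for_def close_id ran_def domIff split: option.splits)
next
  case (MApp Z ss)
  then have IH: "map (subst \<gamma> \<circ> close x k) ss = map (close x k \<circ> subst \<gamma>) ss" by auto
  show ?case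
  proof (cases "\<gamma> (Inr Z)")
    case None
    then show ?thesis using IH by simp
  next
    case (Some u)
    then have "u \<in> ran \<gamma>" by (auto simp: ran_def)
    then have "x \<notin> FV u" "loc_closed 0 u" using assms by (auto simp: fresh_for_def)
    then show ?thesis using Some by (simp add: close_mapply IH del: map_eq_conv)
  qed
qed auto

lemma close_rename: "y \<notin> FV s \<Longrightarrow> close y k (subst1 x (Var y) s) = close x k s"
  by (induction s arbitrary: k) auto

primrec closes :: "'v list \<Rightarrow> nat \<Rightarrow> ('s, 'f, 'v, 'm) mterm \<Rightarrow> ('s, 'f, 'v, 'm) mterm" where
  "closes [] k u = u"
| "closes (x # xs) k u = close x (k + length xs) (closes xs k u)"

lemma closes_simps [simp]:
  "closes xs k (Bnd i) = Bnd i"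
  "closes xs k (Fn f) = Fn f"
  "closes xs k (App s t) = App (closes xs k s) (closes xs k t)"
  "closes xs k (Lam \<sigma> s) = Lam \<sigma> (closes xs (Suc k) s)"
  "closes xs k (MApp Z ss) = MApp Z (map (closes xs k) ss)"
  by (induction xs) (auto simp: map_idI)

lemma closes_Var: "y \<notin> set xs \<Longrightarrow> closes xs k (Var y) = Var y"
  by (induction xs) auto

lemma closes_Var_nth:
  "distinct xs \<Longrightarrow> i < length xs \<Longrightarrow> closes xs k (Var (xs ! i)) = Bnd (k + (length xs - Suc i))"
proof (induction xs arbitrary: i)
  case (Cons x xs)
  then show ?case by (cases i) (auto simp: closes_Var)
qed simp

lemma lift_id: "loc_closed k s \<Longrightarrow> lift n k s = s"
  by (induction s arbitrary: k) (auto simp: list_all_iff map_idI)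

lemma inst_closes:
  fixes u :: "('s, 'f, 'v, 'm) mterm"
  assumes "distinct xs" "length ts = length xs" "\<forall>t \<in> set ts. loc_closed 0 t"
  shows "loc_closed k u \<Longrightarrow>
    inst (rev ts) k (closes xs k u) = subst (map_of (zip (map Inl xs) ts)) u"
proof (induction u arbitrary: k)
  case (Var y)
  show ?case
  proof (cases "y \<in> set xs")
    case True
    then obtain i where i: "i < length xs" "y = xs ! i" by (metis in_set_conv_nth)
    have d: "distinct (map Inl xs :: ('v + 'm) list)" using assms(1) by (simp add: distinct_map)
    have "map_of (zip (map Inl xs) ts) (map Inl xs ! i :: 'v + 'm) = Some (ts ! i)"
      using d assms(2) i by (intro map_of_zip_nth) auto
    moreover have "rev ts ! (length xs - Suc i) = ts ! i"
      using assms(2) i by (simp add: rev_nth)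
    moreover have "loc_closed 0 (ts ! i)" using assms(2,3) i by simp
    moreover have "k + (length xs - Suc i) < k + length xs" using i by simp
    moreover have "closes xs k (Var y :: ('s, 'f, 'v, 'm) mterm) = Bnd (k + (length xs - Suc i))"
      using i assms(1) closes_Var_nth by metis
    ultimately show ?thesis using i assms(2) by (simp add: lift_id del: add_diff_assoc)
  next
    case False
    then have "map_of (zip (map Inl xs) ts) (Inl y :: 'v + 'm) = None"
      using assms(2) by (auto simp: map_of_zip_is_None)
    then show ?thesis using False by (simp add: closes_Var)
  qed
next
  case (MApp Z ss)
  have "map_of (zip (map Inl xs) ts) (Inr Z) = None"
    using assms(2) by (auto simp: map_of_zip_is_None)
  then show ?case using MApp by (auto simp: list_all_iff)
qed auto

context framework begin

lemma lam_rename: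
  "y \<notin> FV s \<Longrightarrow> var_type S y = var_type S x \<Longrightarrow> lam y (subst1 x (Var y) s) = lam x s"
  by (simp add: lam_def close_rename)

lemma subst_lam:
  "(\<And>u. u \<in> ran \<gamma> \<Longrightarrow> loc_closed 0 u) \<Longrightarrow> fresh_for x \<gamma> \<Longrightarrow> subst \<gamma> (lam x s) = lam x (subst \<gamma> s)"
  by (simp add: lam_def subst_close)

lemma lams_closes: "\<exists>\<sigma>s. length \<sigma>s = length xs \<and> lams xs u = foldr Lam \<sigma>s (closes xs 0 u)"
proof (induction xs)
  case (Cons x xs)
  then obtain \<sigma>s where a: "length \<sigma>s = length xs" "lams xs u = foldr Lam \<sigma>s (closes xs 0 u)" by blast
  have "close x k (foldr Lam \<sigma>s w) = foldr Lam \<sigma>s (close x (k + length \<sigma>s) w)"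
    for k and w :: "('s, 'f, 'v, 'm) mterm"
    by (induction \<sigma>s arbitrary: k) auto
  then show ?case using a by (intro exI[of _ "var_type S x # \<sigma>s"]) (simp add: lam_def[of x])
qed simp

lemma mapply_lams:
  assumes "distinct xs" "loc_closed 0 u" "\<forall>t \<in> set ts. loc_closed 0 t"
    and "length xs = length ts \<or> length xs < length ts \<and> (\<nexists>\<sigma> v. u = Lam \<sigma> v)"
  shows "mapply (lams xs u) ts =
    apps (subst (map_of (zip (map Inl xs) ts)) u) (drop (length xs) ts)"
proof -
  obtain \<sigma>s where a: "length \<sigma>s = length xs" "lams xs u = foldr Lam \<sigma>s (closes xs 0 u)"
    using lams_closes by blast
  have l: "lead (foldr Lam \<sigma>s w) = length \<sigma>s + lead w" for w :: "('s, 'f, 'v, 'm) mterm"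
    by (induction \<sigma>s) auto
  have st: "strip (length \<sigma>s) (foldr Lam \<sigma>s w) = w" for w :: "('s, 'f, 'v, 'm) mterm"
    by (induction \<sigma>s) auto
  have z: "lead (closes xs 0 u) = 0" if "\<nexists>\<sigma> v. u = Lam \<sigma> v"
  proof (cases u)
    case (Var y)
    then show ?thesis
    proof (cases "y \<in> set xs")
      case True
      then show ?thesis using Var assms(1) by (auto simp: in_set_conv_nth closes_Var_nth)
    qed (simp add: closes_Var)
  qed (use that in auto)
  have n: "min (length ts) (lead (lams xs u)) = length xs" using assms(4) a l z by auto
  have "inst (rev (take (length xs) ts)) 0 (closes xs 0 u)
     = subst (map_of (zip (map Inl xs) (take (length xs) ts))) u"
    using assms by (intro inst_closes) (auto dest: in_set_takeD)
  also have "zip (map Inl xs :: ('v + 'm) list) (take (length xs) ts) = zip (map Inl xs) ts"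
    by (rule sym) (use zip_append1[of "map Inl xs" "[]" ts] in simp)
  finally show ?thesis unfolding mapply_def n using a st by simp
qed


inductive typed :: "'s ty list \<Rightarrow> ('s, 'f, 'v, 'm) mterm \<Rightarrow> 's ty \<Rightarrow> bool" where
  "typed \<Gamma> (Var x) (var_type S x)"
| "i < length \<Gamma> \<Longrightarrow> typed \<Gamma> (Bnd i) (\<Gamma> ! i)"
| "typed \<Gamma> (Fn f) (sym_type f)"
| "typed \<Gamma> s (Fun \<sigma> \<tau>) \<Longrightarrow> typed \<Gamma> t \<sigma> \<Longrightarrow> typed \<Gamma> (App s t) \<tau>"
| "typed (\<sigma> # \<Gamma>) s \<tau> \<Longrightarrow> typed \<Gamma> (Lam \<sigma> s) (Fun \<sigma> \<tau>)"
| "length ss = mvar_arity S Z \<Longrightarrow> mvar_type S Z = foldr Fun \<sigma>s \<tau> \<Longrightarrow> list_all2 (typed \<Gamma>) ss \<sigma>s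
    \<Longrightarrow> typed \<Gamma> (MApp Z ss) \<tau>"

inductive_cases typ_E: "typed \<Gamma> (Var x) \<tau>" "typed \<Gamma> (Bnd i) \<tau>" "typed \<Gamma> (Fn f) \<tau>"
  "typed \<Gamma> (App s t) \<tau>" "typed \<Gamma> (Lam \<sigma> s) \<tau>" "typed \<Gamma> (MApp Z ss) \<tau>"

lemma typ_loc_closed: "typed \<Gamma> s \<tau> \<Longrightarrow> loc_closed (length \<Gamma>) s"
  by (induction rule: typed.induct) (auto simp: list_all_iff list_all2_conv_all_nth in_set_conv_nth)

lemma typ_close:
  "typed \<Gamma> s \<tau> \<Longrightarrow> typed (\<Gamma> @ [var_type S x]) (close x (length \<Gamma>) s) \<tau>"
proof (induction rule: typed.induct)
  case (1 \<Gamma> y)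
  then show ?case using typed.intros(2)[of "length \<Gamma>" "\<Gamma> @ [var_type S x]"]
    by (auto intro: typed.intros)
next
  case (2 i \<Gamma>)
  then show ?case using typed.intros(2)[of i "\<Gamma> @ [var_type S x]"] by (simp add: nth_append)
next
  case (6 ss Z \<sigma>s \<tau> \<Gamma>)
  show ?case using 6 by (auto intro!: typed.intros(6)[of _ _ \<sigma>s] simp: list_all2_conv_all_nth)
qed (auto intro: typed.intros)

lemma has_type_typ: "has_type s \<tau> \<Longrightarrow> typed [] s \<tau>"
proof (induction rule: has_type.induct)
  case (4 s \<tau> x)
  then show ?case using typ_close[of "[]" s \<tau> x] by (auto simp: lam_def intro: typed.intros)
next
  case (5 ss Z \<sigma>s \<tau>)
  then show ?case by (auto intro!: typed.intros(6)[of _ _ \<sigma>s] simp: list_all2_conv_all_nth)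
qed (auto intro: typed.intros)

lemma typ_lift:
  "typed (\<Gamma> @ \<Delta>) s \<tau> \<Longrightarrow> typed (\<Gamma> @ \<Theta> @ \<Delta>) (lift (length \<Theta>) (length \<Gamma>) s) \<tau>"
proof (induction "\<Gamma> @ \<Delta>" s \<tau> arbitrary: \<Gamma> rule: typed.induct)
  case (2 i)
  show ?case
  proof (cases "i < length \<Gamma>")
    case True
    then show ?thesis using typed.intros(2)[of i "\<Gamma> @ \<Theta> @ \<Delta>"] by (simp add: nth_append)
  next
    case False
    then obtain j where "i = length \<Gamma> + j" by (metis le_add_diff_inverse not_less)
    then show ?thesis using 2 typed.intros(2)[of "i + length \<Theta>" "\<Gamma> @ \<Theta> @ \<Delta>"]
      by (simp add: nth_append)
  qed
next
  case (5 \<sigma> s \<tau>)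
  from 5(2)[of "\<sigma> # \<Gamma>"] show ?case by (auto intro: typed.intros)
next
  case (6 ss Z \<sigma>s \<tau>)
  then show ?case by (auto intro!: typed.intros(6)[of _ _ \<sigma>s] simp: list_all2_conv_all_nth)
qed (auto intro: typed.intros)

lemma typ_inst:
  "typed (\<Gamma> @ \<Theta> @ \<Delta>) s \<tau> \<Longrightarrow> list_all2 (typed \<Delta>) us \<Theta> \<Longrightarrow> typed (\<Gamma> @ \<Delta>) (inst us (length \<Gamma>) s) \<tau>"
proof (induction "\<Gamma> @ \<Theta> @ \<Delta>" s \<tau> arbitrary: \<Gamma> rule: typed.induct)
  case (2 i)
  have len: "length us = length \<Theta>" using 2(2) by (rule list_all2_lengthD)
  consider "i < length \<Gamma>" | "\<not> i < length \<Gamma>" "i < length \<Gamma> + length \<Theta>"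
    | "\<not> i < length \<Gamma> + length \<Theta>" by linarith
  then show ?case
  proof cases
    case 1
    then show ?thesis using typed.intros(2)[of i "\<Gamma> @ \<Delta>"] by (simp add: nth_append)
  next
    case 2
    then have "typed ([] @ \<Delta>) (us ! (i - length \<Gamma>)) (\<Theta> ! (i - length \<Gamma>))"
      using \<open>list_all2 (typed \<Delta>) us \<Theta>\<close> len by (auto simp: list_all2_conv_all_nth)
    moreover obtain j where "i = length \<Gamma> + j" using 2 by (metis le_add_diff_inverse not_less)
    ultimately show ?thesis using typ_lift[of "[]" \<Delta> _ _ \<Gamma>] 2 len by (simp add: nth_append)
  next
    case 3
    then obtain j where "i = length \<Gamma> + length \<Theta> + j" by (metis le_add_diff_inverse not_less)
    then show ?thesis using 2 len typed.intros(2)[of "length \<Gamma> + j" "\<Gamma> @ \<Delta>"]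
      by (simp add: nth_append)
  qed
next
  case (5 \<sigma> s \<tau>)
  from 5(2)[of "\<sigma> # \<Gamma>"] 5(3) show ?case by (auto intro: typed.intros)
next
  case (6 ss Z \<sigma>s \<tau>)
  then show ?case by (auto intro!: typed.intros(6)[of _ _ \<sigma>s] simp: list_all2_conv_all_nth)
qed (auto intro: typed.intros)

lemma close_open: "x \<notin> FV b \<Longrightarrow> loc_closed (Suc k) b \<Longrightarrow> close x k (inst [Var x] k b) = b"
proof (induction b arbitrary: k)
  case (MApp Z ss)
  then show ?case by (auto simp: list_all_iff map_idI)
qed auto

lemma size_inst: "size (inst [Var x] k b) = size b"
proof (induction b arbitrary: k)
  case (MApp Z ss)
  then have "size_list size (map (inst [Var x] k) ss) = size_list size ss"
    by (induction ss) auto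
  then show ?case by simp
qed auto

lemma finite_FV: "finite (FV s)"
  by (induction s) auto

lemma typ_has_type: "typed [] s \<tau> \<Longrightarrow> has_type s \<tau>"
proof (induction s arbitrary: \<tau> rule: measure_induct_rule[where f = size])
  case (less s)
  show ?case
  proof (cases s)
    case (Lam \<sigma> b)
    with less.prems obtain \<rho> where b: "typed [\<sigma>] b \<rho>" "\<tau> = Fun \<sigma> \<rho>" by (auto elim: typ_E)
    have "\<not> {x. var_type S x = \<sigma>} \<subseteq> FV b"
      using infinite_vars finite_FV finite_subset by metis
    then obtain x where x: "var_type S x = \<sigma>" "x \<notin> FV b" by auto
    have "typed ([] @ []) (inst [Var x] (length ([] :: 's ty list)) b) \<rho>"
      using b(1) x(1) typed.intros(1)[of "[]" x] by (intro typ_inst[of _ "[\<sigma>]"]) auto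
    then have "has_type (inst [Var x] 0 b) \<rho>" using less.IH Lam by (simp add: size_inst)
    from has_type.intros(4)[OF this, of x] show ?thesis
      using x b Lam close_open[OF x(2), of 0] typ_loc_closed[OF b(1)] by (simp add: lam_def)
  next
    case (MApp Z ss)
    with less.prems obtain \<sigma>s where a: "length ss = mvar_arity S Z" "mvar_type S Z = foldr Fun \<sigma>s \<tau>"
      "list_all2 (typed []) ss \<sigma>s" by (auto elim: typ_E)
    have "list_all2 has_type ss \<sigma>s" unfolding list_all2_conv_all_nth
    proof (intro conjI allI impI)
      show "length ss = length \<sigma>s" using a(3) by (rule list_all2_lengthD)
      fix i assume i: "i < length ss"
      then have "size (ss ! i) < size s" using MApp
        using size_list_estimation'[of "ss ! i" ss "size (ss ! i)" size]
        by (simp add: less_Suc_eq_le)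
      then show "has_type (ss ! i) (\<sigma>s ! i)"
        using less.IH i a(3) by (auto simp: list_all2_conv_all_nth)
    qed
    then show ?thesis using a MApp by (auto intro: has_type.intros)
  next
    case (App s1 s2)
    with less.prems obtain \<sigma> where "typed [] s1 (Fun \<sigma> \<tau>)" "typed [] s2 \<sigma>" by (auto elim: typ_E)
    then have "has_type s1 (Fun \<sigma> \<tau>)" "has_type s2 \<sigma>" using less.IH App by auto
    then show ?thesis using App has_type.intros(3) by blast
  qed (use less in \<open>auto elim!: typ_E intro: has_type.intros\<close>)
qed

lemma has_type_iff_typ: "has_type s \<tau> \<longleftrightarrow> typed [] s \<tau>"
  using has_type_typ typ_has_type by blast

lemma typ_unique: "typed \<Gamma> s \<tau> \<Longrightarrow> typed \<Gamma> s \<tau>' \<Longrightarrow> \<tau> = \<tau>'"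
proof (induction \<Gamma> s \<tau> arbitrary: \<tau>' rule: typed.induct)
  case (4 \<Gamma> s \<sigma> \<tau> t)
  from 4(5) obtain \<sigma>' where "typed \<Gamma> s (Fun \<sigma>' \<tau>')" by (auto elim: typ_E)
  then show ?case using 4(3) by blast
next
  case (5 \<sigma> \<Gamma> s \<tau>)
  from 5(3) obtain \<rho> where "\<tau>' = Fun \<sigma> \<rho>" "typed (\<sigma> # \<Gamma>) s \<rho>" by (auto elim: typ_E)
  then show ?case using 5(2) by blast
next
  case (6 ss Z \<sigma>s \<tau> \<Gamma>)
  from 6(4) obtain \<sigma>s' where a: "mvar_type S Z = foldr Fun \<sigma>s' \<tau>'" "list_all2 (typed \<Gamma>) ss \<sigma>s'"
    by (auto elim: typ_E)
  have "length ss = length \<sigma>s" "length ss = length \<sigma>s'"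
    using a(2) 6(3) by (auto simp: list_all2_conv_all_nth)
  then have "length \<sigma>s = length \<sigma>s'" by simp
  moreover have "length as = length bs \<Longrightarrow> foldr Fun as u = foldr Fun bs v \<Longrightarrow> u = v"
    for as bs and u v :: "'s ty" by (induction as bs rule: list_induct2) auto
  ultimately show ?case using a(1) 6(2) by metis
qed (auto elim: typ_E)

lemma has_type_unique: "has_type s \<tau> \<Longrightarrow> has_type s \<tau>' \<Longrightarrow> \<tau> = \<tau>'"
  using typ_unique by (auto simp: has_type_iff_typ)

lemma typ_weaken: "typed [] s \<tau> \<Longrightarrow> typed \<Gamma> s \<tau>"
  using typ_lift[of "[]" "[]" s \<tau> \<Gamma>] typ_loc_closed[of "[]" s \<tau>] by (simp add: lift_id)

lemma typ_apps: "typed \<Gamma> s (foldr Fun \<sigma>s \<tau>) \<Longrightarrow> list_all2 (typed \<Gamma>) ts \<sigma>s \<Longrightarrow> typed \<Gamma> (apps s ts) \<tau>"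
proof (induction ts arbitrary: s \<sigma>s)
  case (Cons t ts)
  then obtain \<sigma> \<sigma>s' where "\<sigma>s = \<sigma> # \<sigma>s'" "typed \<Gamma> t \<sigma>" "list_all2 (typed \<Gamma>) ts \<sigma>s'"
    by (auto simp: list_all2_Cons1)
  then show ?case using Cons.IH[of "App s t" \<sigma>s'] Cons.prems(1) typed.intros(4) by auto
qed simp

lemma typ_strip:
  "typed \<Gamma> u (foldr Fun \<sigma>s \<tau>) \<Longrightarrow> length \<sigma>s \<le> lead u \<Longrightarrow> typed (rev \<sigma>s @ \<Gamma>) (strip (length \<sigma>s) u) \<tau>"
proof (induction \<sigma>s arbitrary: \<Gamma> u)
  case (Cons \<sigma> \<sigma>s)
  then obtain \<sigma>' b where "u = Lam \<sigma>' b" by (cases u) auto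
  then show ?case using Cons by (auto elim: typ_E)
qed simp

lemma typ_mapply:
  assumes "typed [] u (foldr Fun \<sigma>s \<tau>)" "list_all2 (typed \<Gamma>) ts \<sigma>s"
  shows "typed \<Gamma> (mapply u ts) \<tau>"
proof -
  let ?n = "min (length ts) (lead u)"
  have len: "length ts = length \<sigma>s" using assms(2) by (rule list_all2_lengthD)
  have "foldr Fun \<sigma>s \<tau> = foldr Fun (take ?n \<sigma>s) (foldr Fun (drop ?n \<sigma>s) \<tau>)"
    by (metis append_take_drop_id comp_apply foldr_append)
  then have "typed \<Gamma> u (foldr Fun (take ?n \<sigma>s) (foldr Fun (drop ?n \<sigma>s) \<tau>))"
    using typ_weaken[OF assms(1), of \<Gamma>] by simp
  from typ_strip[OF this] have "typed (rev (take ?n \<sigma>s) @ \<Gamma>) (strip ?n u) (foldr Fun (drop ?n \<sigma>s) \<tau>)"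
    using len by simp
  then have "typed ([] @ \<Gamma>) (inst (rev (take ?n ts)) (length ([] :: 's ty list)) (strip ?n u))
      (foldr Fun (drop ?n \<sigma>s) \<tau>)"
    using assms(2) by (intro typ_inst[of _ "rev (take ?n \<sigma>s)"]) (auto simp: list_all2_takeI)
  then show ?thesis unfolding mapply_def Let_def
    using assms(2) by (auto intro!: typ_apps[of _ _ "drop ?n \<sigma>s"] list_all2_dropI)
qed

lemma typ_subst:
  assumes "\<And>x u. \<gamma> (Inl x) = Some u \<Longrightarrow> has_type u (var_type S x)"
    and "\<And>Z u. \<gamma> (Inr Z) = Some u \<Longrightarrow> has_type u (mvar_type S Z)"
  shows "typed \<Gamma> s \<tau> \<Longrightarrow> typed \<Gamma> (subst \<gamma> s) \<tau>"
proof (induction rule: typed.induct)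
  case (1 \<Gamma> x)
  then show ?case using assms(1)[of x]
    by (auto split: option.splits intro: typed.intros typ_weaken simp: has_type_iff_typ)
next
  case (6 ss Z \<sigma>s \<tau> \<Gamma>)
  then have l: "list_all2 (typed \<Gamma>) (map (subst \<gamma>) ss) \<sigma>s" by (auto simp: list_all2_conv_all_nth)
  show ?case
  proof (cases "\<gamma> (Inr Z)")
    case None
    then show ?thesis using 6 l by (auto intro: typed.intros)
  next
    case (Some u)
    then show ?thesis using 6 l assms(2)[OF Some] by (auto simp: has_type_iff_typ intro: typ_mapply)
  qed
qed (auto intro: typed.intros)

lemma has_type_subst:
  assumes "\<And>x u. \<gamma> (Inl x) = Some u \<Longrightarrow> has_type u (var_type S x)"
    and "\<And>Z u. \<gamma> (Inr Z) = Some u \<Longrightarrow> has_type u (mvar_type S Z)"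
    and "has_type s \<tau>"
  shows "has_type (subst \<gamma> s) \<tau>"
  using typ_subst[OF assms(1,2)] assms(3) by (auto simp: has_type_iff_typ)


lemma FMV_simps:
  "FMV (Var x) = {}" "FMV (Bnd i) = {}" "FMV (Fn f) = {}" "FMV (App s t) = FMV s \<union> FMV t"
  "FMV (Lam \<sigma> s) = FMV s" "FMV (MApp Z ss) = insert Z (\<Union> (FMV ` set ss))"
  by (auto simp: FMV_def)

lemma FMV_close [simp]: "FMV (close x k s) = FMV s"
  by (induction s arbitrary: k) (auto simp: FMV_simps)

lemma FMV_lift [simp]: "FMV (lift n k s) = FMV s"
  by (induction s arbitrary: k) (auto simp: FMV_simps)

lemma FMV_inst: "FMV s = {} \<Longrightarrow> \<forall>u \<in> set us. FMV u = {} \<Longrightarrow> FMV (inst us k s) = {}"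
proof (induction s arbitrary: k)
  case (Bnd i)
  have "us ! (i - k) \<in> set us" if "\<not> i < k" "i < k + length us" using that by (intro nth_mem) auto
  then show ?case using Bnd by (simp add: FMV_simps)
qed (simp_all add: FMV_simps)

lemma FMV_strip: "FMV (strip n s) = FMV s"
  by (induction n s rule: strip.induct) (auto simp: FMV_simps)

lemma FMV_apps: "FMV (apps s ts) = FMV s \<union> \<Union> (FMV ` set ts)"
  by (induction ts arbitrary: s) (auto simp: FMV_simps)

lemma FMV_mapply:
  assumes "FMV u = {}" "\<forall>t \<in> set ts. FMV t = {}"
  shows "FMV (mapply u ts) = {}"
proof -
  let ?n = "min (length ts) (lead u)"
  have "FMV (inst (rev (take ?n ts)) 0 (strip ?n u)) = {}"
    using assms by (intro FMV_inst) (auto simp: FMV_strip dest: in_set_takeD)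
  then show ?thesis using assms(2) unfolding mapply_def Let_def FMV_apps
    by (auto dest: in_set_dropD)
qed

lemma FMV_subst:
  assumes "\<And>u. u \<in> ran \<gamma> \<Longrightarrow> FMV u = {}"
  shows "Inr ` FMV s \<subseteq> dom \<gamma> \<Longrightarrow> FMV (subst \<gamma> s) = {}"
proof (induction s)
  case (Var x)
  then show ?case using assms by (auto simp: FMV_simps ran_def split: option.splits)
next
  case (MApp Z ss)
  then obtain u where u: "\<gamma> (Inr Z) = Some u" by (auto simp: FMV_simps)
  have "FMV u = {}" using assms u by (auto simp: ran_def)
  moreover have "FMV (subst \<gamma> s) = {}" if "s \<in> set ss" for s
  proof (rule MApp.IH[OF that])
    have "FMV s \<subseteq> FMV (MApp Z ss)" using that by (auto simp: FMV_simps)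
    then show "Inr ` FMV s \<subseteq> dom \<gamma>" using MApp.prems by blast
  qed
  ultimately show ?case using u FMV_mapply[of u "map (subst \<gamma>) ss"] by simp
qed (auto simp: FMV_simps)

lemma has_type_loc_closed: "has_type s \<tau> \<Longrightarrow> loc_closed 0 s"
  using typ_loc_closed[of "[]"] by (simp add: has_type_iff_typ)

lemma subst_has_type:
  assumes "substitution \<gamma>" "has_type s \<tau>"
  shows "has_type (subst \<gamma> s) \<tau>"
  using assms by (intro has_type_subst) (auto simp: substitution_def)

lemma subst_terms:
  assumes "substitution \<gamma>" "s \<in> meta_terms" "Inr ` FMV s \<subseteq> dom \<gamma>"
  shows "subst \<gamma> s \<in> terms"
proof -
  have "FMV u = {}" if "u \<in> ran \<gamma>" for u
  proof -
    from that obtain b where "\<gamma> b = Some u" by (auto simp: ran_def)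
    then show ?thesis using assms(1) by (cases b) (auto simp: substitution_def terms_def)
  qed
  then show ?thesis using FMV_subst[of \<gamma> s] assms subst_has_type[OF assms(1)]
    by (simp add: terms_def meta_terms_def) blast
qed

lemma has_type_App: "has_type (App s t) \<tau> \<longleftrightarrow> (\<exists>\<sigma>. has_type s (Fun \<sigma> \<tau>) \<and> has_type t \<sigma>)"
  unfolding has_type_iff_typ by (auto elim: typ_E intro: typed.intros)

lemma has_type_beta:
  assumes "has_type s \<rho>" "has_type (App (lam x s) t) \<tau>"
  shows "has_type (subst1 x t s) \<tau>"
proof -
  from assms(2) have b: "typed [var_type S x] (close x 0 s) \<tau>" and t: "typed [] t (var_type S x)"
    unfolding has_type_iff_typ lam_def by (auto elim!: typ_E)
  have "typed ([] @ []) (inst [t] (length ([] :: 's ty list)) (close x 0 s)) \<tau>"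
    using b t by (intro typ_inst[of _ "[var_type S x]"]) auto
  moreover have "inst (rev [t]) 0 (closes [x] 0 s) = subst (map_of (zip (map Inl [x]) [t])) s"
    using has_type_loc_closed assms(1) t by (intro inst_closes) (auto simp: has_type_iff_typ)
  ultimately show ?thesis by (simp add: has_type_iff_typ)
qed

lemma step_preserves_type:
  assumes "\<forall>\<rho> \<in> R. is_rule \<rho>" "step R s t"
  shows "s \<in> terms \<and> t \<in> terms \<and> (\<forall>\<sigma>. has_type s \<sigma> \<longrightarrow> has_type t \<sigma>)"
  using assms(2)
proof induction
  case (rule l r \<delta>)
  from rule(1) assms(1) have "is_rule (l, r)" by blast
  then obtain \<sigma> where lr: "has_type l \<sigma>" "has_type r \<sigma>" "FMV r \<subseteq> FMV l" by auto
  have u: "\<tau> = \<sigma>" if "has_type (subst \<delta> l) \<tau>" for \<tau>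
    using that subst_has_type[OF rule(2) lr(1)] has_type_unique by blast
  have "l \<in> meta_terms" "r \<in> meta_terms" using lr by (auto simp: meta_terms_def)
  moreover have "Inr ` FMV l \<subseteq> dom \<delta>" using rule(3) by simp
  moreover have "Inr ` FMV r \<subseteq> dom \<delta>" unfolding rule(3) using lr(3) by (rule image_mono)
  ultimately have "subst \<delta> l \<in> terms" "subst \<delta> r \<in> terms"
    using subst_terms[OF rule(2)] by blast+
  then show ?case using subst_has_type[OF rule(2) lr(2)] u by blast
next
  case (beta s x t)
  have "FMV s = {}" "FMV t = {}" using beta by (auto simp: terms_def FMV_simps)
  then have "FMV (subst1 x t s) = {}" by (intro FMV_subst) auto
  moreover from beta(1) obtain \<rho> where "has_type s \<rho>" by (auto simp: terms_def meta_terms_def)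
  then have p: "has_type (App (lam x s) t) \<tau> \<Longrightarrow> has_type (subst1 x t s) \<tau>" for \<tau>
    by (rule has_type_beta)
  moreover from beta(2) obtain \<tau> where "has_type (App (lam x s) t) \<tau>"
    by (auto simp: terms_def meta_terms_def)
  then have "has_type (subst1 x t s) \<tau>" by (rule p)
  ultimately have "subst1 x t s \<in> terms" unfolding terms_def meta_terms_def by blast
  then show ?case using beta(2) p by blast
next
  case (app_left s s' t)
  then have p: "has_type (App s t) \<tau> \<Longrightarrow> has_type (App s' t) \<tau>" for \<tau>
    unfolding has_type_App by blast
  moreover from app_left have "FMV (App s' t) = {}" by (simp add: terms_def FMV_simps)
  ultimately have "App s' t \<in> terms"
    using app_left unfolding terms_def meta_terms_def by blast
  then show ?case using app_left p by blast
next
  case (app_right t t' s)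
  then have p: "has_type (App s t) \<tau> \<Longrightarrow> has_type (App s t') \<tau>" for \<tau>
    unfolding has_type_App by blast
  moreover from app_right have "FMV (App s t') = {}" by (simp add: terms_def FMV_simps)
  ultimately have "App s t' \<in> terms"
    using app_right unfolding terms_def meta_terms_def by blast
  then show ?case using app_right p by blast
next
  case (lam s s' x)
  from lam.IH obtain \<sigma> where s: "has_type s \<sigma>" "has_type s' \<sigma>" "FMV s = {}" "FMV s' = {}"
    by (auto simp: terms_def meta_terms_def)
  have "\<tau> = Fun (var_type S x) \<sigma>" if "has_type (lam x s) \<tau>" for \<tau>
    using that has_type.intros(4)[OF s(1)] has_type_unique by blast
  moreover have "has_type (lam x s) (Fun (var_type S x) \<sigma>)" "has_type (lam x s') (Fun (var_type S x) \<sigma>)"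
    using s has_type.intros(4) by blast+
  moreover have "FMV (lam x s) = {}" "FMV (lam x s') = {}" using s by (simp_all add: lam_def FMV_simps)
  ultimately show ?case unfolding terms_def meta_terms_def by blast
qed

end

end

theory Submission
  imports Defs
begin

text \<open>
  Monotonicity and meta-stability of \<open>\<succsim>\<close>, together with \<open>\<rightarrow>\<^sub>\<beta> \<subseteq> \<succsim>\<close>, give \<open>\<rightarrow>\<^sub>R \<subseteq> \<succsim>\<close>. Hence an
  infinite chain satisfies \<open>t\<^sub>i \<succsim> s\<^bsub>i+1\<^esub>\<close> throughout, and \<open>s\<^sub>i \<succ> t\<^sub>i\<close> or \<open>s\<^sub>i \<succcurlyeq> t\<^sub>i\<close> depending on whether
  the \<open>i\<close>-th pair is in \<open>P\<^sub>1\<close> or \<open>P\<^sub>2\<close>. Infinitely many pairs from \<open>P\<^sub>1\<close> would yield an infinite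
  \<open>\<succ>\<close>-descent through the \<open>t\<^sub>i\<close>, so some tail of the chain uses only \<open>P\<^sub>2\<close>; each of the flags
  minimal, computable and formative is inherited by tails.
\<close>

context framework begin

section \<open>Rewriting inside applications\<close>

lemma terms_subset_meta_terms: "terms \<subseteq> meta_terms"
  by (auto simp: terms_def)

lemma App_termsD: "App s t \<in> terms \<Longrightarrow> s \<in> terms \<and> t \<in> terms"
  by (auto simp: terms_def meta_terms_def FMV_simps has_type_App)

lemma apps_termsD: "apps s ts \<in> terms \<Longrightarrow> s \<in> terms"
  by (induction ts arbitrary: s) (auto dest: App_termsD)

lemma steps_terms:
  assumes "\<forall>\<rho> \<in> R. is_rule \<rho>" "(step R)\<^sup>*\<^sup>* s t" "s \<in> terms"
  shows "t \<in> terms"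
  using assms(2,3) by induction (use step_preserves_type[OF assms(1)] in blast)+

lemma steps_App_left:
  assumes "\<forall>\<rho> \<in> R. is_rule \<rho>" "(step R)\<^sup>*\<^sup>* s s'" "App s t \<in> terms"
  shows "(step R)\<^sup>*\<^sup>* (App s t) (App s' t)"
  using assms(2,3)
proof induction
  case (step y z)
  \<comment> \<open>\<open>step.app_left\<close> demands a well-typed source for every single step,
    so typing is carried along the reduction.\<close>
  then have "App y t \<in> terms" using steps_terms[OF assms(1)] by blast
  then show ?case using step step.app_left by (meson rtranclp.rtrancl_into_rtrancl)
qed simp

lemma steps_App_right:
  assumes "\<forall>\<rho> \<in> R. is_rule \<rho>" "(step R)\<^sup>*\<^sup>* t t'" "App s t \<in> terms"
  shows "(step R)\<^sup>*\<^sup>* (App s t) (App s t')"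
  using assms(2,3)
proof induction
  case (step y z)
  then have "App s y \<in> terms" using steps_terms[OF assms(1)] by blast
  then show ?case using step step.app_right by (meson rtranclp.rtrancl_into_rtrancl)
qed simp

text \<open>As \<open>apps\<close> is a left fold, each argument is absorbed into the head before
  the remaining ones are treated; the induction therefore lets the head itself rewrite from
  \<open>a\<close> to \<open>b\<close>.\<close>

lemma steps_apps:
  assumes R: "\<forall>\<rho> \<in> R. is_rule \<rho>"
  shows "list_all2 (step R)\<^sup>*\<^sup>* us ws \<Longrightarrow> (step R)\<^sup>*\<^sup>* a b \<Longrightarrow> apps a us \<in> terms \<Longrightarrow>
    (step R)\<^sup>*\<^sup>* (apps a us) (apps b ws)"
proof (induction us ws arbitrary: a b rule: list_all2_induct)
  case (Cons u us w ws)
  have t: "App a u \<in> terms" using Cons.prems(2) apps_termsD by simp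
  have l: "(step R)\<^sup>*\<^sup>* (App a u) (App b u)" by (rule steps_App_left[OF R Cons.prems(1) t])
  have "(step R)\<^sup>*\<^sup>* (App b u) (App b w)"
    by (rule steps_App_right[OF R Cons.hyps(1) steps_terms[OF R l t]])
  with l have "(step R)\<^sup>*\<^sup>* (App a u) (App b w)" by simp
  then show ?case using Cons.IH Cons.prems(2) by simp
qed simp

section \<open>Containment of rewriting in the monotonic quasi-ordering\<close>

lemma step_imp_ge:
  assumes ge: "monotonic ge" "meta_stable ge" "\<forall>s t. beta_step s t \<longrightarrow> ge s t"
    and R: "\<forall>\<rho> \<in> R. is_rule \<rho>" "\<forall>(l, r) \<in> R. ge l r"
    and "step R s t"
  shows "ge s t"
  using assms(6)
proof induction
  case (rule l r \<delta>)
  then have "is_rule (l, r)" "ge l r" using R by blast+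
  \<comment> \<open>A rewrite step instantiates exactly the meta-variables of \<open>l\<close>,
    while \<open>meta_stable\<close> asks for those of \<open>l\<close> and \<open>r\<close>;
    \<open>FMV r \<subseteq> FMV l\<close> makes the two domains agree.\<close>
  then have "closed_pattern l" "r \<in> meta_terms" "FMV l \<union> FMV r = FMV l"
    by (auto simp: meta_terms_def)
  then show ?case using ge(2) rule \<open>ge l r\<close> unfolding meta_stable_def by metis
next
  case (beta s x t)
  \<comment> \<open>The rule \<open>step.beta\<close> does not depend on the rule set, so this is
    also a \<open>beta_step\<close>.\<close>
  then show ?case using ge(3) step.beta by blast
next
  case (app_left s s' t)
  \<comment> \<open>\<open>monotonic\<close> speaks about meta-terms only; type preservation applied
    to this step provides them.\<close>
  have "step R (App s t) (App s' t)" using app_left by (intro step.app_left)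
  then have "App s t \<in> meta_terms" "App s' t \<in> meta_terms" "s \<in> meta_terms" "s' \<in> meta_terms"
    using step_preserves_type[OF R(1)] app_left.hyps(1) terms_subset_meta_terms by blast+
  then show ?case using ge(1) app_left.IH unfolding monotonic_def by blast
next
  case (app_right t t' s)
  have "step R (App s t) (App s t')" using app_right by (intro step.app_right)
  then have "App s t \<in> meta_terms" "App s t' \<in> meta_terms" "t \<in> meta_terms" "t' \<in> meta_terms"
    using step_preserves_type[OF R(1)] app_right.hyps(1) terms_subset_meta_terms by blast+
  then show ?case using ge(1) app_right.IH unfolding monotonic_def by blast
next
  case (lam s s' x)
  then have "s \<in> meta_terms" "s' \<in> meta_terms"
    using step_preserves_type[OF R(1)] terms_subset_meta_terms by blast+
  then show ?case using ge(1) lam.IH unfolding monotonic_def by blast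
qed

lemma steps_imp_ge:
  assumes ge: "monotonic ge" "meta_stable ge" "\<forall>s t. beta_step s t \<longrightarrow> ge s t" "quasi_ordering ge"
    and R: "\<forall>\<rho> \<in> R. is_rule \<rho>" "\<forall>(l, r) \<in> R. ge l r"
    and "(step R)\<^sup>*\<^sup>* s t" "s \<in> terms"
  shows "ge s t"
  using assms(7,8)
proof induction
  case base
  then show ?case using ge(4) terms_subset_meta_terms
    by (auto simp: quasi_ordering_def reflp_on_def)
next
  case (step y z)
  then have "ge y z" using step_imp_ge[OF ge(1-3) R] by blast
  moreover have "y \<in> terms" "z \<in> terms"
    using step_preserves_type[OF R(1) step.hyps(2)] by blast+
  ultimately show ?case using step ge(4) terms_subset_meta_terms
    unfolding quasi_ordering_def transp_on_def by blast
qed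

section \<open>Descent along a chain\<close>

lemma inf_chain_conns:
  assumes "inf_chain P R \<rho> s t \<gamma>" "\<forall>\<rho> \<in> R. is_rule \<rho>"
  shows "(step R)\<^sup>*\<^sup>* (t i) (s (Suc i))"
proof -
  obtain f us ws where "t i = apps (Fn f) us" "s (Suc i) = apps (Fn f) ws"
    "list_all2 (step R)\<^sup>*\<^sup>* us ws" "t i \<in> terms"
    using assms(1) unfolding inf_chain_def by blast
  then show ?thesis using steps_apps[OF assms(2), of us ws "Fn f" "Fn f"] by simp
qed

lemma inf_chain_stable:
  assumes "inf_chain P R \<rho> s t \<gamma>" "meta_stable rel" "\<rho> i = (l, p, A)" "is_dp (l, p, A)" "rel l p"
  shows "rel (s i) (t i)"
proof -
  have "substitution (\<gamma> i)" "dom (\<gamma> i) = Inr ` (FMV l \<union> FMV p)"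
    "s i = subst (\<gamma> i) l" "t i = subst (\<gamma> i) p"
    using assms(1,3) unfolding inf_chain_def by blast+
  then show ?thesis using assms(2,4,5) unfolding meta_stable_def by simp
qed

text \<open>If strict decreases recurred forever, every \<open>t i\<close> would lie
  \<open>gt\<close>-above some other member of the sequence, so the set of all \<open>t i\<close>
  would have no minimal element.\<close>

lemma finitely_many_strict_decreases:
  fixes s t :: "nat \<Rightarrow> ('s, 'f, 'v, 'm) mterm"
  assumes trip: "reduction_triple ge1 ge2 gt"
    and terms: "\<And>i. s i \<in> terms" "\<And>i. t i \<in> terms"
    and conn: "\<And>i. ge1 (t i) (s (Suc i))"
    and dec: "\<And>i. gt (s i) (t i) \<or> ge2 (s i) (t i)"
  shows "\<exists>N. \<forall>i \<ge> N. \<not> gt (s i) (t i)"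
proof (rule ccontr)
  assume "\<nexists>N. \<forall>i \<ge> N. \<not> gt (s i) (t i)"
  then have inf: "\<exists>j \<ge> N. gt (s j) (t j)" for N by blast
  have m: "s i \<in> meta_terms" "t i \<in> meta_terms" for i
    using terms terms_subset_meta_terms by blast+
  have ge1_gt: "gt a c" if "ge1 a b" "gt b c" "a \<in> meta_terms" "b \<in> meta_terms" "c \<in> meta_terms"
    for a b c using trip that unfolding reduction_triple_def by blast
  have ge2_gt: "gt a c" if "ge2 a b" "gt b c" "a \<in> meta_terms" "b \<in> meta_terms" "c \<in> meta_terms"
    for a b c using trip that unfolding reduction_triple_def by blast
  have gt_gt: "gt a c" if "gt a b" "gt b c" "a \<in> meta_terms" "b \<in> meta_terms" "c \<in> meta_terms"
    for a b c using trip that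
    unfolding reduction_triple_def wf_strict_ordering_def transp_on_def by blast
  \<comment> \<open>Downward induction from \<open>j\<close>: a strict decrease at \<open>j\<close>
    is moved back to \<open>i\<close>, since \<open>ge1\<close>, \<open>ge2\<close> and
    \<open>gt\<close> are all absorbed when composed with \<open>gt\<close> on the left.\<close>
  have pull: "gt (s i) (t j)" if "i \<le> j" "gt (s j) (t j)" for i j
    using that
  proof (induction rule: inc_induct)
    case (step i)
    then have "gt (t i) (t j)" using ge1_gt[OF conn] m by blast
    then show ?case using dec[of i] gt_gt ge2_gt m by blast
  qed
  \<comment> \<open>The search starts at \<open>Suc i\<close> because the connection leads from
    \<open>t i\<close> to \<open>s (Suc i)\<close>.\<close>
  have "\<exists>j. gt (t i) (t j)" for i
    using inf[of "Suc i"] pull[of "Suc i"] ge1_gt[OF conn] m by blast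
  moreover have "wfp_on meta_terms gt\<inverse>\<inverse>"
    using trip by (simp add: reduction_triple_def wf_strict_ordering_def)
  then have "\<exists>z \<in> range t. \<forall>y. gt\<inverse>\<inverse> y z \<longrightarrow> y \<notin> range t"
    unfolding wfp_on_iff_ex_minimal using m(2)
    by (elim allE[of _ "range t"] impE) auto
  then obtain z where "z \<in> range t" "\<And>y. gt z y \<Longrightarrow> y \<notin> range t" by auto
  ultimately show False by auto
qed

section \<open>Shifting chains and their flags\<close>

lemma inf_chain_mono: "inf_chain P R \<rho> s t \<gamma> \<Longrightarrow> P \<subseteq> Q \<Longrightarrow> inf_chain Q R \<rho> s t \<gamma>"
  unfolding inf_chain_def by blast

text \<open>Each chain condition concerns an index and at most its successor, so it survives a
  shift; membership in \<open>Q\<close> is needed only from \<open>N\<close> on.\<close>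

lemma inf_chain_tail:
  assumes "inf_chain P R \<rho> s t \<gamma>" "\<And>i. i \<ge> N \<Longrightarrow> \<rho> i \<in> Q"
  shows "inf_chain Q R (\<lambda>i. \<rho> (i + N)) (\<lambda>i. s (i + N)) (\<lambda>i. t (i + N)) (\<lambda>i. \<gamma> (i + N))"
  unfolding inf_chain_def
proof (intro allI)
  fix i
  show "\<rho> (i + N) \<in> Q \<and> s (i + N) \<in> terms \<and> t (i + N) \<in> terms \<and>
     (\<forall>l p A. \<rho> (i + N) = (l, p, A) \<longrightarrow>
        substitution (\<gamma> (i + N)) \<and> dom (\<gamma> (i + N)) = Inr ` (FMV l \<union> FMV p) \<and>
        respects_conds (\<gamma> (i + N)) A \<and>
        s (i + N) = subst (\<gamma> (i + N)) l \<and> t (i + N) = subst (\<gamma> (i + N)) p) \<and>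
     (\<exists>f us ws. t (i + N) = apps (Fn f) us \<and> s (Suc i + N) = apps (Fn f) ws \<and>
        list_all2 (step R)\<^sup>*\<^sup>* us ws)"
    using assms(1)[unfolded inf_chain_def, rule_format, of "i + N"] assms(2)[of "i + N"] by simp
qed

lemma minimal_chain_tail: "minimal_chain R t \<Longrightarrow> minimal_chain R (\<lambda>i. t (i + N))"
  unfolding minimal_chain_def by blast

lemma computable_chain_tail:
  assumes "computable_chain U R \<rho> \<gamma>"
  shows "computable_chain U R (\<lambda>i. \<rho> (i + N)) (\<lambda>i. \<gamma> (i + N))"
  unfolding computable_chain_def
proof (intro conjI)
  show "\<forall>a b. step R a b \<longrightarrow> step U a b" using assms unfolding computable_chain_def by (rule conjunct1)
  note * = assms[unfolded computable_chain_def, THEN conjunct2]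
  show "\<forall>i l p A v B xs. \<rho> (i + N) = (l, p, A) \<longrightarrow> (\<forall>(Z, j) \<in> B. 1 \<le> j) \<longrightarrow> beta_sub B p v \<longrightarrow>
      respects_conds (\<gamma> (i + N)) B \<longrightarrow> distinct xs \<longrightarrow> FV v = set xs \<longrightarrow>
      computable (comp_set U) (subst (\<gamma> (i + N)) (lams xs v))"
    by (rule allI, rule spec[OF *])
qed

lemma formative_chain_tail:
  assumes "formative_chain R \<rho> t \<gamma>"
  shows "formative_chain R (\<lambda>i. \<rho> (i + N)) (\<lambda>i. t (i + N)) (\<lambda>i. \<gamma> (i + N))"
  using assms unfolding formative_chain_def by simp

section \<open>Finiteness and infinity of the reduced problem\<close>

lemma reduction_triple_eventually:
  assumes trip: "reduction_triple ge1 ge2 gt" and dpp: "is_dpp (P1 \<union> P2, R, m, f)"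
    and R: "\<forall>(l, r) \<in> R. ge1 l r" and P1: "\<forall>(l, p, A) \<in> P1. gt l p"
    and P2: "\<forall>(l, p, A) \<in> P2. ge2 l p"
    and chain: "inf_chain (P1 \<union> P2) R \<rho> s t \<gamma>"
  shows "\<exists>N. \<forall>i \<ge> N. \<rho> i \<in> P2"
proof -
  have ge1: "monotonic ge1" "meta_stable ge1" "\<forall>s t. beta_step s t \<longrightarrow> ge1 s t" "quasi_ordering ge1"
    and stable: "meta_stable ge2" "meta_stable gt"
    using trip unfolding reduction_triple_def by blast+
  have rules: "\<forall>\<rho> \<in> R. is_rule \<rho>" using dpp by simp
  have terms: "s i \<in> terms" "t i \<in> terms" and \<rho>: "\<rho> i \<in> P1 \<union> P2" for i
    using chain unfolding inf_chain_def by blast+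
  have dp: "is_dp (\<rho> i)" for i using \<rho>[of i] dpp by auto
  have gt: "gt (s i) (t i)" if "\<rho> i \<in> P1" for i
  proof -
    obtain l p A where e: "\<rho> i = (l, p, A)" by (cases "\<rho> i")
    then have "gt l p" using P1 that by auto
    then show ?thesis using inf_chain_stable[OF chain stable(2) e] dp[of i] e by metis
  qed
  have ge2: "ge2 (s i) (t i)" if "\<rho> i \<in> P2" for i
  proof -
    obtain l p A where e: "\<rho> i = (l, p, A)" by (cases "\<rho> i")
    then have "ge2 l p" using P2 that by auto
    then show ?thesis using inf_chain_stable[OF chain stable(1) e] dp[of i] e by metis
  qed
  have "ge1 (t i) (s (Suc i))" for i
    by (rule steps_imp_ge[OF ge1 rules R inf_chain_conns[OF chain rules] terms(2)])
  then have "\<exists>N. \<forall>i \<ge> N. \<not> gt (s i) (t i)"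
    using gt ge2 \<rho> terms by (intro finitely_many_strict_decreases[OF trip]) blast+
  \<comment> \<open>A pair from \<open>P1\<close> beyond \<open>N\<close> would force a strict
    decrease there, so only \<open>P2\<close> remains.\<close>
  then show ?thesis using gt \<rho> by blast
qed

lemma dpp_finite_reduction_triple:
  assumes "reduction_triple ge1 ge2 gt" "is_dpp (P1 \<union> P2, R, m, f)"
    and "\<forall>(l, r) \<in> R. ge1 l r" "\<forall>(l, p, A) \<in> P1. gt l p" "\<forall>(l, p, A) \<in> P2. ge2 l p"
    and fin: "dpp_finite (P2, R, m, f)"
  shows "dpp_finite (P1 \<union> P2, R, m, f)"
proof (rule ccontr)
  assume "\<not> dpp_finite (P1 \<union> P2, R, m, f)"
  then obtain \<rho> s t \<gamma> where chain: "inf_chain (P1 \<union> P2) R \<rho> s t \<gamma>"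
    and flags: "\<forall>U. m = Computable U \<longrightarrow> computable_chain U R \<rho> \<gamma>"
      "m = Minimal \<longrightarrow> minimal_chain R t" "f = Formative \<longrightarrow> formative_chain R \<rho> t \<gamma>"
    by auto
  obtain N where "\<And>i. i \<ge> N \<Longrightarrow> \<rho> i \<in> P2"
    using reduction_triple_eventually[OF assms(1-5) chain] by blast
  note chain' = inf_chain_tail[OF chain this]
  have "\<forall>U. m = Computable U \<longrightarrow> computable_chain U R (\<lambda>i. \<rho> (i + N)) (\<lambda>i. \<gamma> (i + N))"
    using flags(1) by (simp add: computable_chain_tail)
  moreover have "m = Minimal \<longrightarrow> minimal_chain R (\<lambda>i. t (i + N))"
    using flags(2) by (simp add: minimal_chain_tail)
  moreover have "f = Formative \<longrightarrow> formative_chain R (\<lambda>i. \<rho> (i + N)) (\<lambda>i. t (i + N)) (\<lambda>i. \<gamma> (i + N))"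
    using flags(3) by (simp add: formative_chain_tail)
  ultimately have "\<not> dpp_finite (P2, R, m, f)"
    unfolding dpp_finite.simps not_not using chain' by (intro exI conjI)
  with fin show False by contradiction
qed

text \<open>Non-termination concerns \<open>R\<close> alone, and a chain over \<open>P\<close> is a
  chain over \<open>Q\<close> with the same pairs, hence still conservative.\<close>

lemma dpp_infinite_mono:
  assumes "dpp_infinite (P, R, m, f)" "P \<subseteq> Q"
  shows "dpp_infinite (Q, R, m, f)"
  using assms(1) inf_chain_mono[OF _ assms(2)] unfolding dpp_infinite.simps by meson

end

theorem theorem49:
  fixes S :: "('s, 'f, 'v, 'm) signature"
    and data :: "('s, 'f, 'v, 'm) dpp \<Rightarrow> ('s, 'f, 'v, 'm) triple_data option"
  assumes "framework S"
    and "\<And>P R m f P1 P2 ge1 ge2 gt.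
      data (P, R, m, f) = Some (P1, P2, ge1, ge2, gt) \<Longrightarrow>
        framework.is_dpp S (P, R, m, f) \<and> P = P1 \<union> P2 \<and> P1 \<inter> P2 = {} \<and>
        framework.reduction_triple S ge1 ge2 gt \<and>
        (\<forall>(l, r) \<in> R. ge1 l r) \<and>
        (\<forall>(l, p, A) \<in> P1. gt l p) \<and>
        (\<forall>(l, p, A) \<in> P2. ge2 l p)"
  shows "framework.processor S (triple_proc data) \<and>
    framework.sound S (triple_proc data) \<and> framework.complete S (triple_proc data)"
proof -
  interpret framework S by fact
  \<comment> \<open>The result is always a singleton, also when no data is given (then
    \<open>M'\<close> is \<open>M\<close>). So \<open>NO\<close> never occurs, and all three
    properties become implications between \<open>M\<close> and \<open>M'\<close>.\<close>
  have key: "\<exists>M'. triple_proc data M = Problems {M'} \<and> (is_dpp M \<longrightarrow> is_dpp M') \<and>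
    (dpp_finite M' \<longrightarrow> dpp_finite M) \<and> (dpp_infinite M' \<longrightarrow> dpp_infinite M)" for M
  proof -
    obtain P R m f where M: "M = (P, R, m, f)" by (cases M)
    show ?thesis
    proof (cases "data M")
      case None
      then show ?thesis using M by simp
    next
      case (Some d)
      then obtain P1 P2 ge1 ge2 gt where d: "data (P, R, m, f) = Some (P1, P2, ge1, ge2, gt)"
        using M by (cases d) auto
      from assms(2)[OF d] have h: "is_dpp (P1 \<union> P2, R, m, f)" "P = P1 \<union> P2"
        "reduction_triple ge1 ge2 gt" "\<forall>(l, r) \<in> R. ge1 l r"
        "\<forall>(l, p, A) \<in> P1. gt l p" "\<forall>(l, p, A) \<in> P2. ge2 l p" by blast+
      have "triple_proc data M = Problems {(P2, R, m, f)}" using d M by simp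
      moreover have "is_dpp (P2, R, m, f)" using h(1) by simp
      moreover have "dpp_finite (P2, R, m, f) \<longrightarrow> dpp_finite M"
        using dpp_finite_reduction_triple[OF h(3,1,4-6)] M h(2) by blast
      moreover have "dpp_infinite (P2, R, m, f) \<longrightarrow> dpp_infinite M"
        using dpp_infinite_mono[of P2 R m f P] M h(2) by blast
      ultimately show ?thesis by blast
    qed
  qed
  have "processor (triple_proc data)"
    unfolding processor_def using key by (metis result.inject singletonD)
  moreover have "sound (triple_proc data)"
    unfolding sound_def using key by (metis result.inject singletonI)
  moreover have "complete (triple_proc data)"
    unfolding complete_def using key by (metis result.distinct(1) result.inject singletonD)
  ultimately show ?thesis by blast
qed

end
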